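(* In the two-sample normal means problem described in the context, with fixed $\beta\in(1/2,1)$ and $r>0$, the Higher Criticism statistic of the P-values $\bar\pi_1,\dots,\bar\pi_N$ is asymptotically powerful whenever $r>\rho_{\mathsf{high}}(\beta)$ and asymptotically powerless whenever $r<\rho_{\mathsf{high}}(\beta)$, where $\rho_{\mathsf{high}}(\beta)=2(\beta-1/2)$ for $1/2<\beta<3/4$ and $\rho_{\mathsf{high}}(\beta)=2(1-\sqrt{1-\beta})^2$ for $3/4\le\beta<1$.
   Context: Asymptotic setting $N\to\infty$. Let $\nu_1,\dots,\nu_N\in\mathbb R$ be arbitrary (unknown) means, $\epsilon_N=N^{-\beta}$, and $\nu_i^\pm=\nu_i\pm\sqrt{2r\log N}$. The data $X_1,\dots,X_N,Y_1,\dots,Y_N$ are mutually independent. Under $H_0$: $X_i,Y_i\sim\mathcal N(\nu_i,1)$. Under $H_1$: $X_i\sim\mathcal N(\nu_i,1)$ and $Y_i\sim(1-\epsilon_N)\mathcal N(\nu_i,1)+\frac{\epsilon_N}{2}\mathcal N(\nu_i^+,1)+\frac{\epsilon_N}{2}\mathcal N(\nu_i^-,1)$. The P-values are $\bar\pi_i=\Pr\big(|Z|\ge|Y_i-X_i|/\sqrt2\big)$ with $Z\sim\mathcal N(0,1)$. Higher Criticism: fix $\gamma_0\in(0,1)$. For P-values $p_1,\dots,p_N$ with order statistics $p_{(1)}\le\dots\le p_{(N)}$, $\mathrm{HC}^\star=\max_{1\le i\le\gamma_0N}\sqrt N\,\frac{i/N-p_{(i)}}{\sqrt{p_{(i)}(1-p_{(i)})}}$.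 A sequence of statistics $T_N$ is asymptotically powerful if there exist thresholds $h_N$ with $\Pr_{H_0}(T_N>h_N)+\Pr_{H_1}(T_N\le h_N)\to0$, and asymptotically powerless if for every sequence of thresholds $h_N$, $\Pr_{H_0}(T_N>h_N)+\Pr_{H_1}(T_N\le h_N)\to1$. *)

theory Defs
  imports "HOL-Probability.Probability"
begin

definition rho_high :: "real \<Rightarrow> real" where
  "rho_high \<beta> = (if \<beta> < 3/4 then 2 * (\<beta> - 1/2) else 2 * (1 - sqrt (1 - \<beta>))^2)"

definition eps_N :: "real \<Rightarrow> nat \<Rightarrow> real" where
  "eps_N \<beta> N = real N powr (- \<beta>)"

definition shift_N :: "real \<Rightarrow> nat \<Rightarrow> real" where
  "shift_N r N = sqrt (2 * r * ln (real N))"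

definition pbar :: "real \<Rightarrow> real" where
  "pbar t = measure (density lborel std_normal_density) {z. \<bar>z\<bar> \<ge> \<bar>t\<bar> / sqrt 2}"

definition order_stat :: "nat \<Rightarrow> (nat \<Rightarrow> real) \<Rightarrow> nat \<Rightarrow> real" where
  "order_stat N p i = sort (map p [0..<N]) ! (i - 1)"

definition HC :: "real \<Rightarrow> nat \<Rightarrow> (nat \<Rightarrow> real) \<Rightarrow> real" where
  "HC \<gamma>0 N p = Max {sqrt (real N) * (real i / real N - order_stat N p i)
                        / sqrt (order_stat N p i * (1 - order_stat N p i))
                      | i. 1 \<le> i \<and> real i \<le> \<gamma>0 * real N}"

definition null_model :: "(nat \<Rightarrow> nat \<Rightarrow> real) \<Rightarrow> nat \<Rightarrow> (nat \<Rightarrow> real \<times> real) measure" where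
  "null_model \<nu> N = (\<Pi>\<^sub>M i\<in>{..<N}.
      density lborel (normal_density (\<nu> N i) 1) \<Otimes>\<^sub>M density lborel (normal_density (\<nu> N i) 1))"

definition alt_model :: "real \<Rightarrow> real \<Rightarrow> (nat \<Rightarrow> nat \<Rightarrow> real) \<Rightarrow> nat \<Rightarrow> (nat \<Rightarrow> real \<times> real) measure" where
  "alt_model \<beta> r \<nu> N = (\<Pi>\<^sub>M i\<in>{..<N}.
      density lborel (normal_density (\<nu> N i) 1) \<Otimes>\<^sub>M
      density lborel (\<lambda>y. (1 - eps_N \<beta> N) * normal_density (\<nu> N i) 1 y
                         + eps_N \<beta> N / 2 * normal_density (\<nu> N i + shift_N r N) 1 y
                         + eps_N \<beta> N / 2 * normal_density (\<nu> N i - shift_N r N) 1 y))"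

definition HC_stat :: "real \<Rightarrow> nat \<Rightarrow> (nat \<Rightarrow> real \<times> real) \<Rightarrow> real" where
  "HC_stat \<gamma>0 N \<omega> = HC \<gamma>0 N (\<lambda>i. pbar (snd (\<omega> i) - fst (\<omega> i)))"

definition test_risk :: "('a measure) \<Rightarrow> ('a measure) \<Rightarrow> ('a \<Rightarrow> real) \<Rightarrow> real \<Rightarrow> real" where
  "test_risk M0 M1 T h = measure M0 {\<omega> \<in> space M0. T \<omega> > h} + measure M1 {\<omega> \<in> space M1. T \<omega> \<le> h}"

definition asymp_powerful :: "(nat \<Rightarrow> 'a measure) \<Rightarrow> (nat \<Rightarrow> 'a measure) \<Rightarrow> (nat \<Rightarrow> 'a \<Rightarrow> real) \<Rightarrow> bool" where
  "asymp_powerful M0 M1 T \<longleftrightarrow>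
     (\<exists>h :: nat \<Rightarrow> real. (\<lambda>N. test_risk (M0 N) (M1 N) (T N) (h N)) \<longlonglongrightarrow> 0)"

definition asymp_powerless :: "(nat \<Rightarrow> 'a measure) \<Rightarrow> (nat \<Rightarrow> 'a measure) \<Rightarrow> (nat \<Rightarrow> 'a \<Rightarrow> real) \<Rightarrow> bool" where
  "asymp_powerless M0 M1 T \<longleftrightarrow>
     (\<forall>h :: nat \<Rightarrow> real. (\<lambda>N. test_risk (M0 N) (M1 N) (T N) (h N)) \<longlonglongrightarrow> 1)"

end

theory Submission
  imports Defs "HOL-Real_Asymp.Real_Asymp"
begin

text \<open>
  The normalised differences \<open>Z\<^sub>i = (Y\<^sub>i - X\<^sub>i) / sqrt 2\<close> are i.i.d. with a law that does not involve
  the means: standard normal under the null, and under the alternative a mixture with shift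
  \<open>\<plusminus> s * sqrt (2 * ln N)\<close>, where \<open>s = sqrt (r / 2)\<close>. Higher Criticism depends on the data
  only through them.

  Power. With the threshold \<open>N powr \<delta>\<close>, a Chernoff bound for each order statistic shows
  that the null exceedance probability vanishes. Under the alternative it is enough to look at a
  single level: the number of \<open>\<bar>Z\<^sub>i\<bar>\<close> above \<open>u * sqrt (2 * ln N)\<close> exceeds its null
  expectation by a polynomial factor times its null standard deviation, for \<open>u = 1\<close> if
  \<open>s > 1 - sqrt (1 - \<beta>)\<close> and \<open>u = 2 * s\<close> otherwise.

  Powerlessness. The total variation distance of the two laws of \<open>(Z\<^sub>1, \<dots>, Z\<^sub>N)\<close>
  is controlled by \<open>N\<close> times the squared Hellinger distance of their marginals. The latter is
  \<open>o (1 / N)\<close> below the boundary, by a second moment bound for the likelihood ratio truncated at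
  \<open>\<bar>z\<bar> \<le> sqrt (2 * ln N)\<close>.
\<close>

subsection \<open>Higher Criticism and counts\<close>

text \<open>In a sorted list the entries at most \<open>x\<close> form a prefix, so position
  \<open>k\<close> lies in it exactly when the prefix has more than \<open>k\<close>
  entries.\<close>

lemma sorted_nth_le_iff:
  fixes xs :: "'a :: linorder list"
  assumes "sorted xs" "k < length xs"
  shows "xs ! k \<le> x \<longleftrightarrow> k < length (filter (\<lambda>y. y \<le> x) xs)"
  using assms
proof (induction xs arbitrary: k)
  case (Cons a xs)
  have gt: "filter (\<lambda>y. y \<le> x) xs = []" if "\<not> a \<le> x"
    using Cons.prems(1) that by (force simp: filter_empty_conv)
  show ?case
  proof (cases k)
    case 0
    then show ?thesis using gt by auto
  next
    case (Suc l)
    have "\<not> xs ! l \<le> x" if "\<not> a \<le> x"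
      using Cons.prems Suc that order_trans[of a "xs ! l" x] by auto
    then show ?thesis using Cons Suc gt by auto
  qed
qed simp

text \<open>Sorting preserves the number of entries at most \<open>x\<close>. All probability
  estimates for order statistics go through this translation into counts. The index
  \<open>i - 1\<close> in \<open>order_stat\<close> turns the strict prefix bound into
  \<open>i \<le> card\<close>.\<close>

lemma order_stat_le_iff:
  assumes "1 \<le> i" "i \<le> N"
  shows "order_stat N p i \<le> x \<longleftrightarrow> i \<le> card {j. j < N \<and> p j \<le> x}"
proof -
  have "length (filter (\<lambda>y. y \<le> x) (sort (map p [0..<N]))) = length (filter (\<lambda>y. y \<le> x) (map p [0..<N]))"
    by (metis filter_sort length_sort)
  also have "\<dots> = card {j. j < N \<and> p j \<le> x}"
    by (subst length_filter_conv_card) (auto intro!: arg_cong[where f=card])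
  finally show ?thesis
    unfolding order_stat_def using assms by (subst sorted_nth_le_iff) auto
qed

lemma order_stat_in:
  assumes "1 \<le> i" "i \<le> N"
  shows "order_stat N p i \<in> p ` {..<N}"
proof -
  have "order_stat N p i \<in> set (sort (map p [0..<N]))"
    unfolding order_stat_def using assms by (intro nth_mem) auto
  then show ?thesis by auto
qed

lemma order_stat_cong: "(\<And>i. i < N \<Longrightarrow> p i = q i) \<Longrightarrow> order_stat N p = order_stat N q"
  unfolding order_stat_def by (intro ext arg_cong2[where f=nth] arg_cong[where f=sort] map_cong) auto

lemma HC_cong: "(\<And>i. i < N \<Longrightarrow> p i = q i) \<Longrightarrow> HC \<gamma> N p = HC \<gamma> N q"
  unfolding HC_def using order_stat_cong[of N p q] by simp

lemma finite_HC_indices: "finite {i. 1 \<le> i \<and> real i \<le> c}"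
  by (rule finite_subset[of _ "{..nat \<lfloor>c\<rfloor>}"]) (auto simp: le_nat_floor)

lemma HC_indices_le:
  assumes "\<gamma> < 1" "1 \<le> i" "real i \<le> \<gamma> * real N"
  shows "i \<le> N"
  using mult_right_mono[of \<gamma> 1 "real N"] assms by linarith

lemma card_eq_sum_indicator:
  fixes N :: nat
  shows "real (card {j. j < N \<and> \<omega> j \<in> A}) = (\<Sum>j<N. indicator A (\<omega> j))"
proof -
  have "(\<Sum>j<N. indicator A (\<omega> j)) = (\<Sum>j<N. if \<omega> j \<in> A then 1 else 0 :: real)"
    by (intro sum.cong) auto
  also have "\<dots> = real (card {j. j < N \<and> \<omega> j \<in> A})"
    by (subst sum.If_cases) (auto intro!: arg_cong[where f=card])
  finally show ?thesis ..
qed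

text \<open>By the translation into counts, a sublevel set is the event that a finite sum of
  indicators is at least \<open>i\<close>.\<close>

lemma measurable_order_stat:
  assumes "1 \<le> i" "i \<le> N" and p [measurable]: "\<And>j. j < N \<Longrightarrow> (\<lambda>\<omega>. p \<omega> j) \<in> borel_measurable M"
  shows "(\<lambda>\<omega>. order_stat N (p \<omega>) i) \<in> borel_measurable M"
proof (subst borel_measurable_iff_le, intro allI)
  fix a
  have card: "real (card {j. j < N \<and> p \<omega> j \<le> a}) = (\<Sum>j<N. indicator {..a} (p \<omega> j))" for \<omega>
    using card_eq_sum_indicator[of N "p \<omega>" "{..a}"] by simp
  have [measurable]: "(\<lambda>\<omega>. \<Sum>j<N. indicator {..a} (p \<omega> j) :: real) \<in> borel_measurable M"
    by (intro borel_measurable_sum borel_measurable_indicator' p) (use p in measurable)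
  have "{\<omega> \<in> space M. order_stat N (p \<omega>) i \<le> a}
      = {\<omega> \<in> space M. real i \<le> (\<Sum>j<N. indicator {..a} (p \<omega> j))}"
    using assms by (simp add: order_stat_le_iff flip: card)
  also have "\<dots> \<in> sets M" by measurable
  finally show "{\<omega> \<in> space M. order_stat N (p \<omega>) i \<le> a} \<in> sets M" .
qed

lemma HC_eq_Max_image:
  "HC \<gamma> N p = Max ((\<lambda>i. sqrt (real N) * (real i / real N - order_stat N p i)
      / sqrt (order_stat N p i * (1 - order_stat N p i))) ` {i. 1 \<le> i \<and> real i \<le> \<gamma> * real N})"
  unfolding HC_def by (simp add: setcompr_eq_image)

lemma measurable_HC:
  assumes "\<gamma> < 1" and p: "\<And>j. j < N \<Longrightarrow> (\<lambda>\<omega>. p \<omega> j) \<in> borel_measurable M"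
  shows "(\<lambda>\<omega>. HC \<gamma> N (p \<omega>)) \<in> borel_measurable M"
proof -
  have [measurable]: "(\<lambda>\<omega>. order_stat N (p \<omega>) i) \<in> borel_measurable M"
    if "i \<in> {i. 1 \<le> i \<and> real i \<le> \<gamma> * real N}" for i
    using that assms HC_indices_le by (intro measurable_order_stat) auto
  show ?thesis unfolding HC_eq_Max_image
    by (intro borel_measurable_Max finite_HC_indices) measurable
qed

text \<open>A positive term forces \<open>x < i / N \<le> \<gamma>\<close>, so the factor
  \<open>sqrt (1 - x)\<close> of the denominator is at least \<open>sqrt (1 - \<gamma>)\<close> and
  can be merged with the threshold. What remains compares a count with a mean plus a multiple of the
  root of that mean.\<close>

lemma HC_gt_imp:
  assumes "HC \<gamma> N p > h" "h > 0" "1 \<le> \<gamma> * real N" "0 < \<gamma>" "\<gamma> < 1"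
    and p: "\<And>j. j < N \<Longrightarrow> 0 < p j \<and> p j \<le> 1"
  obtains i x where "1 \<le> i" "i \<le> N" "x = order_stat N p i" "0 < x" "x < 1"
    "real i > real N * x + h * sqrt (1 - \<gamma>) * sqrt (real N * x)"
proof -
  define T where "T i = sqrt (real N) * (real i / real N - order_stat N p i)
      / sqrt (order_stat N p i * (1 - order_stat N p i))" for i
  let ?I = "{i. 1 \<le> i \<and> real i \<le> \<gamma> * real N}"
  have ne: "1 \<in> ?I" using assms by simp
  have "HC \<gamma> N p \<in> T ` ?I" unfolding HC_eq_Max_image T_def
    by (rule Max_in) (use ne finite_HC_indices in auto)
  then obtain i where i: "i \<in> ?I" "T i > h" using assms(1) by auto
  define x where "x = order_stat N p i"
  have iN: "1 \<le> i" "i \<le> N" "real i \<le> \<gamma> * real N" using i assms HC_indices_le by auto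
  then have N: "real N > 0" by simp
  from order_stat_in[OF iN(1,2), of p] p have x: "0 < x" "x \<le> 1" unfolding x_def by auto
  \<comment> \<open>At \<open>x = 1\<close> the denominator vanishes and the quotient is 0 by
    convention, hence not above \<open>h\<close>.\<close>
  have x1: "x < 1" using i(2) \<open>h > 0\<close> x unfolding T_def x_def[symmetric] by (cases "x = 1") auto
  have sx: "sqrt (x * (1 - x)) > 0" using x x1 by simp
  have gt: "sqrt N * (i / N - x) > h * sqrt (x * (1 - x))"
    using i(2) sx unfolding T_def x_def[symmetric] by (simp add: field_simps)
  then have "sqrt N * (i / N - x) > 0" using \<open>h > 0\<close> sx by (smt (verit) mult_pos_pos)
  then have "i / N - x > 0" using N by (simp add: zero_less_mult_iff)
  moreover have "i / N \<le> \<gamma>" using iN N by (simp add: field_simps)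
  ultimately have "1 - \<gamma> \<le> 1 - x" by simp
  then have "sqrt x * sqrt (1 - \<gamma>) \<le> sqrt (x * (1 - x))"
    unfolding real_sqrt_mult using x by (intro mult_left_mono) auto
  then have "h * (sqrt x * sqrt (1 - \<gamma>)) < sqrt N * (i / N - x)"
    using gt \<open>h > 0\<close> by (smt (verit) mult_left_mono)
  then have "sqrt N * (h * (sqrt x * sqrt (1 - \<gamma>))) < sqrt N * (sqrt N * (i / N - x))"
    using N by (intro mult_strict_left_mono) auto
  also have "\<dots> = i - N * x" using N by (simp add: field_simps)
  finally have "real i > real N * x + h * sqrt (1 - \<gamma>) * sqrt (real N * x)"
    by (simp add: real_sqrt_mult mult_ac)
  then show thesis using that iN x x1 x_def by blast
qed

text \<open>A single term bounds the maximum from below. The count gives \<open>x \<le> t\<close>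
  for the \<open>K\<close>-th order statistic \<open>x\<close>; replacing \<open>x\<close> by
  \<open>t\<close> in the numerator and \<open>x * (1 - x)\<close> by \<open>t\<close> in the
  denominator only lowers the term.\<close>

lemma HC_gt_of_count:
  assumes "0 < t" "t < 1" "1 \<le> K" "real K \<le> \<gamma> * real N" "\<gamma> < 1"
    and K: "real K > real N * t + h * sqrt (real N * t)" "h \<ge> 0"
    and p: "\<And>j. j < N \<Longrightarrow> 0 < p j"
    and cnt: "K \<le> card {j. j < N \<and> p j \<le> t}"
  shows "HC \<gamma> N p > h"
proof -
  let ?I = "{i. 1 \<le> i \<and> real i \<le> \<gamma> * real N}"
  define x where "x = order_stat N p K"
  have KN: "K \<le> N" using assms HC_indices_le by auto
  have N: "real N > 0" using KN assms(3) by simp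
  have xt: "x \<le> t" unfolding x_def using order_stat_le_iff[of K N p t] KN assms by simp
  have x0: "0 < x" using order_stat_in[of K N p] KN assms(3) p unfolding x_def by auto
  have "N * t \<le> K" using K by (smt (verit) mult_nonneg_nonneg real_sqrt_ge_zero N \<open>0 < t\<close>)
  then have nn: "0 \<le> K / N - t" using N by (simp add: field_simps)
  have "h < (K - N * t) / sqrt (N * t)"
    using K(1) N \<open>0 < t\<close> by (simp add: field_simps)
  also have "\<dots> = sqrt N * (K / N - t) / sqrt t"
    using N \<open>0 < t\<close> by (simp add: real_sqrt_mult field_simps)
  also have "\<dots> \<le> sqrt N * (K / N - x) / sqrt (x * (1 - x))"
  proof (rule frac_le)
    show "sqrt N * (K / N - t) \<le> sqrt N * (K / N - x)"
      using xt by (intro mult_left_mono) auto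
    have "x * (1 - x) \<le> t * 1" using xt x0 \<open>t < 1\<close> by (intro mult_mono) auto
    then show "sqrt (x * (1 - x)) \<le> sqrt t" by simp
  qed (use nn xt x0 \<open>t < 1\<close> in auto)
  also have "\<dots> \<le> HC \<gamma> N p" unfolding HC_eq_Max_image x_def
    by (rule Max_ge) (use finite_HC_indices assms in auto)
  finally show ?thesis .
qed

subsection \<open>Gaussian shifts and mixtures\<close>

abbreviation gauss :: "real \<Rightarrow> real measure" where
  "gauss c \<equiv> density lborel (normal_density c 1)"

definition mix_density :: "real \<Rightarrow> real \<Rightarrow> real \<Rightarrow> real \<Rightarrow> real" where
  "mix_density e m c x = (1 - e) * normal_density c 1 x + e / 2 * normal_density (c + m) 1 x
     + e / 2 * normal_density (c - m) 1 x"

abbreviation mixture :: "real \<Rightarrow> real \<Rightarrow> real \<Rightarrow> real measure" where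
  "mixture e m c \<equiv> density lborel (mix_density e m c)"

lemma measurable_mix_density [measurable]: "mix_density e m c \<in> borel_measurable borel"
  unfolding mix_density_def[abs_def] by measurable

lemma mix_density_nonneg: "0 \<le> e \<Longrightarrow> e \<le> 1 \<Longrightarrow> 0 \<le> mix_density e m c x"
  unfolding mix_density_def by simp

text \<open>Makes the null model a mixture of weight zero, so that one reduction serves both
  hypotheses.\<close>

lemma mixture_0: "mixture 0 m c = gauss c"
  by (simp add: mix_density_def)

lemma prob_space_gauss: "prob_space (gauss c)"
  by (rule prob_space_normal_density) simp

lemma emeasure_mixture:
  assumes "0 \<le> e" "e \<le> 1" "A \<in> sets borel"
  shows "emeasure (mixture e m c) A = ennreal (1 - e) * emeasure (gauss c) A
    + ennreal (e / 2) * emeasure (gauss (c + m)) A + ennreal (e / 2) * emeasure (gauss (c - m)) A"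
proof -
  have "emeasure (mixture e m c) A = (\<integral>\<^sup>+x. ennreal (mix_density e m c x) * indicator A x \<partial>lborel)"
    using assms by (simp add: emeasure_density)
  also have "\<dots> = (\<integral>\<^sup>+x. ennreal (1 - e) * (ennreal (normal_density c 1 x) * indicator A x)
      + ennreal (e / 2) * (ennreal (normal_density (c + m) 1 x) * indicator A x)
      + ennreal (e / 2) * (ennreal (normal_density (c - m) 1 x) * indicator A x) \<partial>lborel)"
    unfolding mix_density_def using assms
    by (intro nn_integral_cong) (simp add: indicator_def flip: ennreal_mult ennreal_plus)
  finally show ?thesis
    using assms by (simp add: nn_integral_add nn_integral_cmult emeasure_density)
qed

lemma prob_space_mixture:
  assumes "0 \<le> e" "e \<le> 1"
  shows "prob_space (mixture e m c)"
proof
  have "emeasure (gauss a) UNIV = 1" for a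
    using prob_space.emeasure_space_1[OF prob_space_gauss[of a]] by simp
  then show "emeasure (mixture e m c) (space (mixture e m c)) = 1"
    using assms by (simp add: emeasure_mixture flip: ennreal_plus)
qed

lemma measure_mixture:
  assumes "0 \<le> e" "e \<le> 1" "A \<in> sets borel"
  shows "measure (mixture e m c) A = (1 - e) * measure (gauss c) A
    + e / 2 * measure (gauss (c + m)) A + e / 2 * measure (gauss (c - m)) A"
proof -
  interpret G: prob_space "gauss a" for a by (rule prob_space_gauss)
  interpret W: prob_space "mixture e m c" using assms by (intro prob_space_mixture) auto
  have "ennreal (measure (mixture e m c) A) = ennreal ((1 - e) * measure (gauss c) A
    + e / 2 * measure (gauss (c + m)) A + e / 2 * measure (gauss (c - m)) A)"
    using emeasure_mixture[OF assms, of m c] assms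
    by (simp add: W.emeasure_eq_measure G.emeasure_eq_measure flip: ennreal_mult ennreal_plus)
  then show ?thesis using assms by (subst (asm) ennreal_inj) auto
qed

text \<open>The difference of two independent unit normals is normal with variance 2, and division
  by \<open>sqrt 2\<close> restores unit variance.\<close>

lemma distr_gauss_diff:
  "distr (gauss a \<Otimes>\<^sub>M gauss b) borel (\<lambda>(x, y). (y - x) / sqrt 2) = gauss ((b - a) / sqrt 2)"
proof -
  interpret A: prob_space "gauss a" by (rule prob_space_gauss)
  interpret B: prob_space "gauss b" by (rule prob_space_gauss)
  interpret P: pair_prob_space "gauss a" "gauss b" ..
  let ?M = "gauss a \<Otimes>\<^sub>M gauss b"
  have sM: "sets ?M = sets (borel \<Otimes>\<^sub>M borel)" by (intro sets_pair_measure_cong) auto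
  have f: "distr ?M borel fst = gauss a" and s: "distr ?M borel snd = gauss b"
  proof -
    show "distr ?M borel fst = gauss a"
      using B.distr_pair_fst[of "gauss a"] by (simp cong: distr_cong)
    show "distr ?M borel snd = gauss b"
    proof (rule measure_eqI)
      fix S assume "S \<in> sets (distr ?M borel snd)"
      then have S: "S \<in> sets borel" by simp
      have "snd -` S \<inter> space ?M = UNIV \<times> S" by (auto simp: space_pair_measure)
      then have "emeasure (distr ?M borel snd) S = emeasure ?M (UNIV \<times> S)"
        using S by (subst emeasure_distr) auto
      also have "\<dots> = emeasure (gauss a) (space (gauss a)) * emeasure (gauss b) S"
        using S by (subst B.emeasure_pair_measure_Times) auto
      also have "\<dots> = emeasure (gauss b) S" by (simp only: A.emeasure_space_1 mult_1)
      finally show "emeasure (distr ?M borel snd) S = emeasure (gauss b) S" .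
    qed simp
  qed
  \<comment> \<open>The joint law of the two projections is the product measure itself, which is
    their independence.\<close>
  have "distr ?M borel fst \<Otimes>\<^sub>M distr ?M borel snd = distr ?M (borel \<Otimes>\<^sub>M borel) (\<lambda>x. (fst x, snd x))"
    using sM by (simp add: f s distr_id2)
  then have ind: "P.indep_var borel fst borel snd"
    by (subst P.indep_var_distribution_eq) auto
  have d: "distributed ?M lborel fst (normal_density a 1)"
          "distributed ?M lborel snd (normal_density b 1)"
    unfolding distributed_def using f s by (auto cong: distr_cong)
  have D: "distributed ?M lborel (\<lambda>x. fst x - snd x) (normal_density (a - b) (sqrt 2))"
    using P.diff_indep_normal[OF ind _ _ d] by simp
  \<comment> \<open>The factor \<open>- 1 / sqrt 2\<close> also reverses the sign, since
    \<open>D\<close> concerns \<open>fst x - snd x\<close>.\<close>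
  have "distributed ?M lborel (\<lambda>x. 0 + - 1 / sqrt 2 * (fst x - snd x))
      (normal_density (0 + - 1 / sqrt 2 * (a - b)) (\<bar>- 1 / sqrt 2\<bar> * sqrt 2))"
    by (rule P.normal_density_affine[OF D]) auto
  also have "(\<lambda>x :: real \<times> real. 0 + - 1 / sqrt 2 * (fst x - snd x)) = (\<lambda>x. (snd x - fst x) / sqrt 2)"
    by (intro ext) (simp add: algebra_simps diff_divide_distrib)
  also have "0 + - 1 / sqrt 2 * (a - b) = (b - a) / sqrt 2"
    by (simp add: algebra_simps diff_divide_distrib)
  also have "\<bar>- 1 / sqrt 2\<bar> * sqrt 2 = 1" by simp
  finally have "distributed ?M lborel (\<lambda>x. (snd x - fst x) / sqrt 2) (normal_density ((b - a) / sqrt 2) 1)" .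
  then have "distr ?M lborel (\<lambda>x. (snd x - fst x) / sqrt 2) = gauss ((b - a) / sqrt 2)"
    unfolding distributed_def by simp
  then show ?thesis by (simp add: case_prod_beta' cong: distr_cong)
qed

text \<open>The law of the difference is linear in the law of the second coordinate, so the claim
  splits into the Gaussian case with second means \<open>c\<close>, \<open>c + m\<close> and
  \<open>c - m\<close>. The common \<open>c\<close> cancels.\<close>

lemma distr_mixture_diff:
  assumes "0 \<le> e" "e \<le> 1"
  shows "distr (gauss c \<Otimes>\<^sub>M mixture e m c) borel (\<lambda>(x, y). (y - x) / sqrt 2) = mixture e (m / sqrt 2) 0"
proof (rule measure_eqI)
  fix A assume "A \<in> sets (distr (gauss c \<Otimes>\<^sub>M mixture e m c) borel (\<lambda>(x, y). (y - x) / sqrt 2))"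
  then have A [measurable]: "A \<in> sets borel" by simp
  interpret G: prob_space "gauss a" for a by (rule prob_space_gauss)
  interpret W: prob_space "mixture e m c" using assms by (rule prob_space_mixture)
  let ?f = "\<lambda>(x, y). (y - x) / sqrt 2 :: real"
  define B where "B = ?f -` A"
  have [measurable]: "?f \<in> borel_measurable (borel \<Otimes>\<^sub>M borel)" by measurable
  have B [measurable]: "B \<in> sets (borel \<Otimes>\<^sub>M borel)"
    unfolding B_def using measurable_sets[OF \<open>?f \<in> _\<close> A] by (simp add: space_pair_measure)
  have sections: "Pair x -` B \<in> sets borel" for x
    using sets_Pair1[OF B] by simp
  have g: "emeasure (gauss c \<Otimes>\<^sub>M gauss b) B = emeasure (gauss ((b - c) / sqrt 2)) A" for b
  proof -
    have "emeasure (gauss ((b - c) / sqrt 2)) A = emeasure (distr (gauss c \<Otimes>\<^sub>M gauss b) borel ?f) A"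
      by (simp add: distr_gauss_diff)
    also have "\<dots> = emeasure (gauss c \<Otimes>\<^sub>M gauss b) B"
      unfolding B_def by (subst emeasure_distr) (auto simp: space_pair_measure)
    finally show ?thesis ..
  qed
  have meas: "(\<lambda>x. emeasure (gauss b) (Pair x -` B)) \<in> borel_measurable borel" for b
  proof -
    have "B \<in> sets (borel \<Otimes>\<^sub>M gauss b)" 
      using B by (simp cong: sets_pair_measure_cong)
    from G.measurable_emeasure_Pair[OF this] show ?thesis .
  qed
  have pair: "(\<integral>\<^sup>+x. emeasure (gauss b) (Pair x -` B) \<partial>gauss c) = emeasure (gauss c \<Otimes>\<^sub>M gauss b) B" for b
    using B by (intro G.emeasure_pair_measure_alt[symmetric]) (simp cong: sets_pair_measure_cong)
  have "emeasure (distr (gauss c \<Otimes>\<^sub>M mixture e m c) borel ?f) A = emeasure (gauss c \<Otimes>\<^sub>M mixture e m c) B"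
    unfolding B_def by (subst emeasure_distr) (auto simp: space_pair_measure)
  also have "\<dots> = (\<integral>\<^sup>+x. emeasure (mixture e m c) (Pair x -` B) \<partial>gauss c)"
    using B by (intro W.emeasure_pair_measure_alt) (simp cong: sets_pair_measure_cong)
  also have "\<dots> = (\<integral>\<^sup>+x. ennreal (1 - e) * emeasure (gauss c) (Pair x -` B)
    + ennreal (e / 2) * emeasure (gauss (c + m)) (Pair x -` B)
    + ennreal (e / 2) * emeasure (gauss (c - m)) (Pair x -` B) \<partial>gauss c)"
    using assms sections by (intro nn_integral_cong emeasure_mixture) auto
  also have "\<dots> = ennreal (1 - e) * (\<integral>\<^sup>+x. emeasure (gauss c) (Pair x -` B) \<partial>gauss c)
    + ennreal (e / 2) * (\<integral>\<^sup>+x. emeasure (gauss (c + m)) (Pair x -` B) \<partial>gauss c)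
    + ennreal (e / 2) * (\<integral>\<^sup>+x. emeasure (gauss (c - m)) (Pair x -` B) \<partial>gauss c)"
    using meas by (simp add: nn_integral_add nn_integral_cmult)
  also have "\<dots> = emeasure (mixture e (m / sqrt 2) 0) A"
    unfolding pair using assms A by (simp add: g emeasure_mixture)
  finally show "emeasure (distr (gauss c \<Otimes>\<^sub>M mixture e m c) borel ?f) A
      = emeasure (mixture e (m / sqrt 2) 0) A" .
qed simp

text \<open>For \<open>c < a \<le> z\<close> the cross term \<open>(a - c) * (z - a)\<close> is
  nonnegative, so the density centred at \<open>c\<close> is at most
  \<open>exp (- (a - c)^2 / 2)\<close> times the one centred at \<open>a\<close>, which has total
  mass 1. For \<open>a \<le> c\<close> the bound is 1.\<close>

lemma gauss_tail_le:
  "measure (gauss c) {a..} \<le> exp (- (max 0 (a - c))\<^sup>2 / 2)"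
proof -
  interpret G: prob_space "gauss b" for b by (rule prob_space_gauss)
  show ?thesis
  proof (cases "a \<le> c")
    case False
    have le: "normal_density c 1 z * indicator {a..} z \<le> exp (- (a - c)\<^sup>2 / 2) * normal_density a 1 z" for z
    proof (cases "z \<ge> a")
      case True
      have "0 \<le> (a - c) * (z - a)" using True False by simp
      then have "- (z - c)\<^sup>2 / 2 \<le> - (a - c)\<^sup>2 / 2 + - (z - a)\<^sup>2 / 2"
        by (simp add: power2_eq_square field_simps)
      then have "exp (- (z - c)\<^sup>2 / 2) \<le> exp (- (a - c)\<^sup>2 / 2) * exp (- (z - a)\<^sup>2 / 2)"
        by (simp flip: exp_add)
      then show ?thesis using True by (simp add: normal_density_def divide_right_mono)
    qed simp
    have "emeasure (gauss c) {a..} = (\<integral>\<^sup>+z. ennreal (normal_density c 1 z) * indicator {a..} z \<partial>lborel)"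
      by (simp add: emeasure_density)
    also have "\<dots> \<le> (\<integral>\<^sup>+z. ennreal (exp (- (a - c)\<^sup>2 / 2)) * normal_density a 1 z \<partial>lborel)"
    proof (intro nn_integral_mono)
      fix z
      show "ennreal (normal_density c 1 z) * indicator {a..} z
          \<le> ennreal (exp (- (a - c)\<^sup>2 / 2)) * ennreal (normal_density a 1 z)"
        using le[of z] by (cases "a \<le> z") (simp_all flip: ennreal_mult)
    qed
    also have "\<dots> = ennreal (exp (- (a - c)\<^sup>2 / 2)) * emeasure (gauss a) (space (gauss a))"
      by (simp add: nn_integral_cmult emeasure_density)
    also have "\<dots> = exp (- (a - c)\<^sup>2 / 2)" by (simp add: G.emeasure_space_1 del: space_density)
    finally show ?thesis using False by (simp add: G.emeasure_eq_measure max_def)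
  qed (simp add: max_def)
qed

lemma gauss_reflect: "measure (gauss c) {..a} = measure (gauss (- c)) {- a..}"
proof -
  have "emeasure (gauss c) {..a} = (\<integral>\<^sup>+z. ennreal (normal_density c 1 z) * indicator {..a} z \<partial>lborel)"
    by (simp add: emeasure_density)
  also have "\<dots> = (\<integral>\<^sup>+z. ennreal (normal_density c 1 (- z)) * indicator {..a} (- z) \<partial>lborel)"
    by (subst lborel_distr_uminus[symmetric], subst nn_integral_distr) auto
  also have "\<dots> = (\<integral>\<^sup>+z. ennreal (normal_density (- c) 1 z) * indicator {- a..} z \<partial>lborel)"
    by (intro nn_integral_cong) (auto simp: normal_density_def indicator_def power2_commute add.commute)
  also have "\<dots> = emeasure (gauss (- c)) {- a..}" by (simp add: emeasure_density)
  finally show ?thesis by (simp add: measure_def)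
qed

lemma gauss_tail_le': "measure (gauss c) {..a} \<le> exp (- (max 0 (c - a))\<^sup>2 / 2)"
  unfolding gauss_reflect using gauss_tail_le[of "- c" "- a"] by (simp add: algebra_simps)

text \<open>Integrates only over \<open>{a..a+1}\<close>, where the density is at least its value at
  \<open>a + 1\<close>. When \<open>a - c\<close> is of order \<open>sqrt (ln N)\<close>, the loss
  against the upper bound is smaller than any power of \<open>N\<close>.\<close>

lemma gauss_tail_ge:
  assumes "c \<le> a"
  shows "measure (gauss c) {a..} \<ge> exp (- (a - c + 1)\<^sup>2 / 2) / sqrt (2 * pi)"
proof -
  interpret G: prob_space "gauss c" by (rule prob_space_gauss)
  have "ennreal (exp (- (a - c + 1)\<^sup>2 / 2) / sqrt (2 * pi))
      = (\<integral>\<^sup>+z. ennreal (exp (- (a - c + 1)\<^sup>2 / 2) / sqrt (2 * pi)) * indicator {a..a+1} z \<partial>lborel)"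
    by (simp add: nn_integral_cmult_indicator)
  also have "\<dots> \<le> (\<integral>\<^sup>+z. ennreal (normal_density c 1 z) * indicator {a..} z \<partial>lborel)"
  proof (intro nn_integral_mono)
    fix z
    have "exp (- (a - c + 1)\<^sup>2 / 2) \<le> exp (- (z - c)\<^sup>2 / 2)" if "a \<le> z" "z \<le> a + 1"
      using assms that by (simp add: power_mono)
    then show "ennreal (exp (- (a - c + 1)\<^sup>2 / 2) / sqrt (2 * pi)) * indicator {a..a+1} z
        \<le> ennreal (normal_density c 1 z) * indicator {a..} z"
      by (auto simp: indicator_def normal_density_def intro!: ennreal_leI divide_right_mono)
  qed
  also have "\<dots> = emeasure (gauss c) {a..}" by (simp add: emeasure_density)
  finally show ?thesis by (simp add: G.emeasure_eq_measure)
qed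

lemma gauss_two_sided_le:
  "measure (gauss c) {z. a \<le> \<bar>z\<bar>} \<le> exp (- (max 0 (a - c))\<^sup>2 / 2) + exp (- (max 0 (a + c))\<^sup>2 / 2)"
proof -
  interpret G: prob_space "gauss c" by (rule prob_space_gauss)
  have eq: "{z. a \<le> \<bar>z\<bar>} = {a..} \<union> {..- a}" by auto
  have "measure (gauss c) {z. a \<le> \<bar>z\<bar>} \<le> measure (gauss c) {a..} + measure (gauss c) {..- a}"
    unfolding eq by (rule measure_Un_le) auto
  then show ?thesis using gauss_tail_le[of c a] gauss_tail_le'[of c "- a"] by (simp add: add.commute)
qed

section \<open>P-values as functions of the standardised difference\<close>

definition pval :: "real \<Rightarrow> real" where
  "pval z = measure (gauss 0) {w. \<bar>z\<bar> \<le> \<bar>w\<bar>}"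

lemma pbar_eq_pval: "pbar d = pval (d / sqrt 2)"
  unfolding pbar_def pval_def by (simp add: abs_divide)

lemma sets_abs_ge [measurable, simp]: "{w :: real. a \<le> \<bar>w\<bar>} \<in> sets borel"
  by measurable

lemma pval_antimono: "\<bar>z\<bar> \<le> \<bar>w\<bar> \<Longrightarrow> pval w \<le> pval z"
proof -
  interpret G: prob_space "gauss 0" by (rule prob_space_gauss)
  assume "\<bar>z\<bar> \<le> \<bar>w\<bar>"
  then show ?thesis unfolding pval_def by (intro G.finite_measure_mono) auto
qed

lemma pval_pos: "0 < pval z"
proof -
  interpret G: prob_space "gauss 0" by (rule prob_space_gauss)
  have "0 < exp (- (\<bar>z\<bar> + 1)\<^sup>2 / 2) / sqrt (2 * pi)" by simp
  also have "\<dots> \<le> measure (gauss 0) {\<bar>z\<bar>..}" using gauss_tail_ge[of 0 "\<bar>z\<bar>"] by simp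
  also have "\<dots> \<le> pval z" unfolding pval_def by (intro G.finite_measure_mono) auto
  finally show ?thesis .
qed

lemma pval_le_1: "pval z \<le> 1"
proof -
  interpret G: prob_space "gauss 0" by (rule prob_space_gauss)
  show ?thesis unfolding pval_def by simp
qed

lemma pval_le: "0 \<le> z \<Longrightarrow> pval z \<le> 2 * exp (- z\<^sup>2 / 2)"
  unfolding pval_def using gauss_two_sided_le[of 0 z] by (simp add: max_def)

text \<open>\<open>pval\<close> is even and decreasing in \<open>\<bar>z\<bar>\<close>, so its
  negative, frozen on the negative half-line, is monotone and therefore Borel.\<close>

lemma measurable_pval [measurable]: "pval \<in> borel_measurable borel"
proof -
  have "mono (\<lambda>z. - pval (max 0 z))"
    by (auto intro!: monoI pval_antimono)
  then have "(\<lambda>z. - pval (max 0 z)) \<in> borel_measurable borel"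
    by (rule borel_measurable_mono)
  then have "(\<lambda>z. - (- pval (max 0 \<bar>z\<bar>))) \<in> borel_measurable borel"
    by measurable
  then show ?thesis by (simp add: pval_def[abs_def])
qed

text \<open>By monotonicity the event is a two-sided tail starting at the infimum \<open>a\<close>
  of \<open>\<bar>z\<bar>\<close>. If the tail is closed, its mass is at most
  \<open>pval a \<le> x\<close>; otherwise it is approximated from inside. Continuity of
  \<open>pval\<close> is not invoked.\<close>

lemma pval_superuniform:
  assumes "0 \<le> x"
  shows "measure (gauss 0) {z. pval z \<le> x} \<le> x"
proof -
  interpret G: prob_space "gauss 0" by (rule prob_space_gauss)
  let ?U = "{z. pval z \<le> x}"
  show ?thesis
  proof (cases "?U = {}")
    case False
    define a where "a = Inf (abs ` ?U)"
    have bdd: "bdd_below (abs ` ?U)" by (rule bdd_belowI[of _ 0]) auto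
    have lower: "a \<le> \<bar>z\<bar>" if "z \<in> ?U" for z
      unfolding a_def using that bdd by (intro cInf_lower) auto
    show ?thesis
    proof (cases "pval a \<le> x")
      case True
      have "0 \<le> a" unfolding a_def using False by (intro cInf_greatest) auto
      then have "measure (gauss 0) ?U \<le> pval a"
        unfolding pval_def using lower by (intro G.finite_measure_mono) (auto simp: pval_def)
      then show ?thesis using True by simp
    next
      case a: False
      \<comment> \<open>Here \<open>a\<close> is not attained, so the event lies in the open tail,
        the increasing union of the closed tails \<open>B n\<close>. Each \<open>B n\<close> starts
        beyond some \<open>z\<close> of the event, so its mass is at most
        \<open>pval z \<le> x\<close>.\<close>
      define B where "B n = {w :: real. a + 1 / real (Suc n) \<le> \<bar>w\<bar>}" for n
      have B: "range B \<subseteq> sets (gauss 0)" by (auto simp: B_def)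
      have inc: "incseq B"
      proof (rule incseq_SucI)
        fix n
        have "1 / real (Suc (Suc n)) \<le> 1 / real (Suc n)" by (simp add: field_simps)
        then show "B n \<subseteq> B (Suc n)" unfolding B_def by auto
      qed
      have le: "measure (gauss 0) (B n) \<le> x" for n
      proof -
        have "Inf (abs ` ?U) < a + 1 / real (Suc n)" unfolding a_def by simp
        then obtain z where z: "z \<in> ?U" "\<bar>z\<bar> < a + 1 / real (Suc n)"
          using False by (subst (asm) cInf_less_iff) (use bdd in auto)
        have "measure (gauss 0) (B n) \<le> pval z"
          unfolding pval_def B_def using z(2) by (intro G.finite_measure_mono) auto
        then show ?thesis using z(1) by simp
      qed
      have "?U \<subseteq> (\<Union>n. B n)"
      proof
        fix z assume z: "z \<in> ?U"
        have "0 \<le> a" unfolding a_def using False by (intro cInf_greatest) auto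
        then have "\<bar>z\<bar> \<noteq> a" using z a by (auto simp: pval_def)
        then have "a < \<bar>z\<bar>" using lower[OF z] by simp
        then obtain n where "1 / real (Suc n) < \<bar>z\<bar> - a"
          using nat_approx_posE[of "\<bar>z\<bar> - a"] by auto
        then show "z \<in> (\<Union>n. B n)" unfolding B_def by (intro UN_I[of n]) auto
      qed
      then have "measure (gauss 0) ?U \<le> measure (gauss 0) (\<Union>n. B n)"
        using B by (intro G.finite_measure_mono) auto
      also have "\<dots> \<le> x"
        by (rule LIMSEQ_le_const2[OF G.finite_Lim_measure_incseq[OF B inc]]) (use le in auto)
      finally show ?thesis .
    qed
  qed (use assms in simp)
qed

subsection \<open>Reduction to normalised differences\<close>

text \<open>The coordinatewise standardised difference pushes the product of the pair laws to a
  product of identical laws, and Higher Criticism factors through this map. This is where the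
  unknown means \<open>c i\<close> disappear.\<close>

lemma measure_normalised_differences:
  assumes e: "0 \<le> e" "e \<le> 1" and "\<gamma> < 1" and S: "S \<in> sets borel"
  shows "measure (\<Pi>\<^sub>M i\<in>{..<N}. gauss (c i) \<Otimes>\<^sub>M mixture e m (c i))
      {\<omega> \<in> space (\<Pi>\<^sub>M i\<in>{..<N}. gauss (c i) \<Otimes>\<^sub>M mixture e m (c i)). HC_stat \<gamma> N \<omega> \<in> S}
    = measure (\<Pi>\<^sub>M i\<in>{..<N}. mixture e (m / sqrt 2) 0)
      {z \<in> space (\<Pi>\<^sub>M i\<in>{..<N}. mixture e (m / sqrt 2) 0). HC \<gamma> N (\<lambda>i. pval (z i)) \<in> S}"
    (is "measure ?M _ = measure ?M' _")
proof -
  let ?f = "\<lambda>(x, y). (y - x) / sqrt 2 :: real"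
  let ?W = "mixture e (m / sqrt 2) 0"
  let ?H = "\<lambda>z. HC \<gamma> N (\<lambda>i. pval (z i))"
  have pW: "prob_space ?W" using e by (rule prob_space_mixture)
  have pM: "prob_space (gauss (c i) \<Otimes>\<^sub>M mixture e m (c i))" for i
    using e by (intro prob_space_pair prob_space_gauss prob_space_mixture)
  have sM: "sets (gauss (c i) \<Otimes>\<^sub>M mixture e m (c i)) = sets (borel \<Otimes>\<^sub>M borel)" for i
    by (intro sets_pair_measure_cong) auto
  have f: "?f \<in> measurable (gauss (c i) \<Otimes>\<^sub>M mixture e m (c i)) ?W" for i
    using sM[of i] by (subst measurable_cong_sets[OF sM, of _ borel]) auto
  have "product_prob_space (\<lambda>i. gauss (c i) \<Otimes>\<^sub>M mixture e m (c i))" "product_prob_space (\<lambda>i :: nat. ?W)"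
    using pM pW by (auto simp: product_prob_space_def product_prob_space_axioms_def
        product_sigma_finite_def prob_space_imp_sigma_finite)
  then have "distr ?M ?M' (compose {..<N} ?f)
      = (\<Pi>\<^sub>M i\<in>{..<N}. distr (gauss (c i) \<Otimes>\<^sub>M mixture e m (c i)) ?W ?f)"
    using f by (intro distr_PiM_finite_prob_space) auto
  also have "(\<lambda>i. distr (gauss (c i) \<Otimes>\<^sub>M mixture e m (c i)) ?W ?f) = (\<lambda>i. ?W)"
    using distr_mixture_diff[OF e, of "c _" m] by (intro ext) (simp cong: distr_cong)
  finally have D: "?M' = distr ?M ?M' (compose {..<N} ?f)" ..
  have c: "compose {..<N} ?f \<in> measurable ?M ?M'"
  proof (rule measurable_PiM_single')
    fix i assume i: "i \<in> {..<N}"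
    then have "(\<lambda>\<omega>. ?f (\<omega> i)) \<in> measurable ?M ?W"
      by (intro measurable_compose[OF _ f[of i]] measurable_component_singleton)
    then show "(\<lambda>\<omega>. compose {..<N} ?f \<omega> i) \<in> measurable ?M ?W"
      using i by (simp add: compose_def)
  qed (auto simp: compose_def space_PiM PiE_def extensional_def)
  have H: "?H \<in> borel_measurable ?M'"
  proof (rule measurable_HC[OF \<open>\<gamma> < 1\<close>])
    fix j assume "j < N"
    then have "(\<lambda>z. z j) \<in> measurable ?M' ?W" by (intro measurable_component_singleton) auto
    then show "(\<lambda>z. pval (z j)) \<in> borel_measurable ?M'"
      by (rule measurable_compose) (simp add: measurable_pval)
  qed
  have A: "{z \<in> space ?M'. ?H z \<in> S} \<in> sets ?M'"
    using measurable_sets[OF H S] by (simp add: vimage_def Int_def conj_commute)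
  \<comment> \<open>\<open>compose\<close> is undefined at indices from \<open>N\<close> on, but
    \<open>HC\<close> reads only those below \<open>N\<close>.\<close>
  have eq: "HC_stat \<gamma> N \<omega> = ?H (compose {..<N} ?f \<omega>)" for \<omega>
    unfolding HC_stat_def
    by (intro HC_cong) (auto simp: pbar_eq_pval compose_def case_prod_beta')
  have "measure ?M' {z \<in> space ?M'. ?H z \<in> S}
      = measure (distr ?M ?M' (compose {..<N} ?f)) {z \<in> space ?M'. ?H z \<in> S}"
    by (subst D) simp
  also have "\<dots> = measure ?M (compose {..<N} ?f -` {z \<in> space ?M'. ?H z \<in> S} \<inter> space ?M)"
    by (rule measure_distr[OF c A])
  also have "compose {..<N} ?f -` {z \<in> space ?M'. ?H z \<in> S} \<inter> space ?M = {\<omega> \<in> space ?M. HC_stat \<gamma> N \<omega> \<in> S}"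
    using measurable_space[OF c] by (auto simp: eq)
  finally show ?thesis ..
qed

lemma shift_N_eq: "shift_N r N / sqrt 2 = sqrt (r / 2) * sqrt (2 * ln (real N))"
  unfolding shift_N_def by (simp add: real_sqrt_mult real_sqrt_divide field_simps)

lemma eps_N_bounds: "0 < \<beta> \<Longrightarrow> 0 \<le> eps_N \<beta> N \<and> eps_N \<beta> N \<le> 1"
  unfolding eps_N_def by (cases N) (auto simp: powr_minus powr_def field_simps intro!: mult_nonneg_nonneg)

lemma null_model_eq: "null_model \<nu> N = (\<Pi>\<^sub>M i\<in>{..<N}. gauss (\<nu> N i) \<Otimes>\<^sub>M mixture 0 0 (\<nu> N i))"
  unfolding null_model_def mixture_0 ..

lemma alt_model_eq:
  "alt_model \<beta> r \<nu> N = (\<Pi>\<^sub>M i\<in>{..<N}. gauss (\<nu> N i) \<Otimes>\<^sub>M mixture (eps_N \<beta> N) (shift_N r N) (\<nu> N i))"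
  unfolding alt_model_def mix_density_def ..

abbreviation null_law :: "nat \<Rightarrow> (nat \<Rightarrow> real) measure" where
  "null_law N \<equiv> \<Pi>\<^sub>M i\<in>{..<N}. gauss 0"

abbreviation alt_law :: "real \<Rightarrow> real \<Rightarrow> nat \<Rightarrow> (nat \<Rightarrow> real) measure" where
  "alt_law \<beta> s N \<equiv> \<Pi>\<^sub>M i\<in>{..<N}. mixture (eps_N \<beta> N) (s * sqrt (2 * ln (real N))) 0"

lemma HC_risk_eq:
  assumes "0 < \<beta>" "\<gamma> < 1"
  shows "test_risk (null_model \<nu> N) (alt_model \<beta> r \<nu> N) (HC_stat \<gamma> N) h
    = measure (null_law N) {z \<in> space (null_law N). HC \<gamma> N (\<lambda>i. pval (z i)) > h}
    + measure (alt_law \<beta> (sqrt (r / 2)) N) {z \<in> space (alt_law \<beta> (sqrt (r / 2)) N). HC \<gamma> N (\<lambda>i. pval (z i)) \<le> h}"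
  unfolding test_risk_def null_model_eq alt_model_eq
  using measure_normalised_differences[of 0 \<gamma> "{h<..}" N "\<nu> N" 0]
    measure_normalised_differences[of "eps_N \<beta> N" \<gamma> "{..h}" N "\<nu> N" "shift_N r N"]
    eps_N_bounds[of \<beta> N] assms
  by (simp add: mixture_0 shift_N_eq)

subsection \<open>Tail bounds for Higher Criticism\<close>

lemma measurable_count:
  fixes N :: nat
  assumes A: "A \<in> sets Q"
  shows "(\<lambda>\<omega>. real (card {j. j < N \<and> \<omega> j \<in> A})) \<in> borel_measurable (\<Pi>\<^sub>M i\<in>{..<N}. Q)"
  unfolding card_eq_sum_indicator
  by (intro borel_measurable_sum measurable_compose[OF _ borel_measurable_indicator[OF A]]
      measurable_component_singleton)

text \<open>Exponential Markov inequality: by independence the generating function is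
  \<open>q ^ N\<close>, and \<open>1 + x \<le> exp x\<close> replaces it by the Poisson one. The
  sign of \<open>l\<close> is free, so upper and lower tails are both covered.\<close>

lemma chernoff_count:
  fixes Q :: "'a measure" and N :: nat
  assumes Q: "prob_space Q" and A: "A \<in> sets Q"
  defines "P \<equiv> \<Pi>\<^sub>M i\<in>{..<N}. Q"
  shows "measure P {\<omega> \<in> space P. l * k \<le> l * real (card {j. j < N \<and> \<omega> j \<in> A})}
    \<le> exp (real N * measure Q A * (exp l - 1) - l * k)"
proof -
  interpret Q: prob_space Q by fact
  interpret P: prob_space P unfolding P_def by (rule prob_space_PiM[OF Q])
  interpret PP: product_sigma_finite "\<lambda>_ :: nat. Q" by standard
  define f where "f x = ennreal (exp (l * indicator A x))" for x
  have f [measurable]: "f \<in> borel_measurable Q" unfolding f_def using A by measurable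
  let ?S = "\<lambda>\<omega>. \<Sum>j<N. indicat_real A (\<omega> j)"
  let ?E = "{\<omega> \<in> space P. l * k \<le> l * ?S \<omega>}"
  define q where "q = 1 + measure Q A * (exp l - 1)"
  have q: "q = exp l * measure Q A + (1 - measure Q A)" unfolding q_def by (simp add: algebra_simps)
  have q0: "0 \<le> q" unfolding q by simp
  have [measurable]: "?S \<in> borel_measurable P"
    using measurable_count[OF A] unfolding card_eq_sum_indicator P_def by simp
  have E: "?E \<in> sets P" by measurable
  have "emeasure P ?E = (\<integral>\<^sup>+\<omega>. indicator ?E \<omega> \<partial>P)" using E by simp
  also have "\<dots> \<le> (\<integral>\<^sup>+\<omega>. ennreal (exp (- l * k)) * (\<Prod>j<N. f (\<omega> j)) \<partial>P)"
  proof (intro nn_integral_mono)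
    fix \<omega>
    have "(\<Prod>j<N. f (\<omega> j)) = ennreal (exp (l * ?S \<omega>))"
      unfolding f_def by (simp add: prod_ennreal sum_distrib_left flip: exp_sum)
    then have "ennreal (exp (- l * k)) * (\<Prod>j<N. f (\<omega> j)) = ennreal (exp (l * ?S \<omega> - l * k))"
      by (simp add: exp_diff exp_minus field_simps flip: ennreal_mult)
    then show "indicator ?E \<omega> \<le> ennreal (exp (- l * k)) * (\<Prod>j<N. f (\<omega> j))"
      by (auto simp: indicator_def)
  qed
  also have "\<dots> = ennreal (exp (- l * k)) * (\<integral>\<^sup>+\<omega>. (\<Prod>j<N. f (\<omega> j)) \<partial>P)"
    unfolding P_def by (intro nn_integral_cmult) measurable
  also have "(\<integral>\<^sup>+\<omega>. (\<Prod>j<N. f (\<omega> j)) \<partial>P) = (\<integral>\<^sup>+x. f x \<partial>Q) ^ N"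
    unfolding P_def by (subst PP.product_nn_integral_prod) auto
  also have "(\<integral>\<^sup>+x. f x \<partial>Q) = (\<integral>\<^sup>+x. ennreal (exp l) * indicator A x + indicator (space Q - A) x \<partial>Q)"
    by (intro nn_integral_cong) (auto simp: f_def indicator_def)
  also have "\<dots> = ennreal (exp l) * emeasure Q A + emeasure Q (space Q - A)"
    using A by (subst nn_integral_add) (auto simp: nn_integral_cmult)
  also have "\<dots> = ennreal q"
    unfolding q using A by (simp add: Q.emeasure_eq_measure Q.prob_compl flip: ennreal_mult ennreal_plus)
  also have "ennreal (exp (- l * k)) * ennreal q ^ N = ennreal (exp (- l * k) * q ^ N)"
    using q0 by (simp add: ennreal_power flip: ennreal_mult)
  also have "\<dots> \<le> ennreal (exp (- l * k) * exp (measure Q A * (exp l - 1)) ^ N)"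
    using q0 by (intro ennreal_leI mult_left_mono power_mono) (auto simp: q_def)
  also have "exp (- l * k) * exp (measure Q A * (exp l - 1)) ^ N = exp (real N * measure Q A * (exp l - 1) - l * k)"
  proof -
    have "exp (measure Q A * (exp l - 1)) ^ N = exp (real N * (measure Q A * (exp l - 1)))"
      by (rule exp_of_nat_mult[symmetric])
    then show ?thesis by (simp add: algebra_simps flip: exp_add)
  qed
  finally show ?thesis
    unfolding card_eq_sum_indicator by (simp add: P.emeasure_eq_measure)
qed

text \<open>Poisson large deviations for a count \<open>i\<close> that exceeds the mean
  \<open>m\<close> by \<open>a * sqrt m\<close>. For \<open>i \<le> 9 * m\<close> the decay is
  Gaussian; beyond that it is \<open>exp (- i)\<close> or better. For small \<open>i\<close> this is
  too weak, and \<open>m \<le> i^2 / a^2\<close> gives the polynomial third term, which is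
  affordable because few \<open>i\<close> are at most \<open>sqrt a\<close>.\<close>

lemma poisson_chernoff:
  fixes i m a :: real
  assumes m: "0 < m" "m + a * sqrt m = i" and i: "1 \<le> i" and a: "1 \<le> a"
  shows "\<exists>l > 0. exp (m * (exp l - 1) - l * i)
    \<le> exp (- a\<^sup>2 / 16) + exp (- sqrt a) + (if i \<le> sqrt a then 3 * i / a\<^sup>2 else 0)"
proof (cases "i \<le> 9 * m")
  case True
  have sm: "0 < sqrt m" using m by simp
  have d: "i - m = a * sqrt m" using m by simp
  \<comment> \<open>The factor 8 makes \<open>l \<le> 1\<close> when \<open>i \<le> 9 * m\<close>,
    as the quadratic bound on \<open>exp\<close> requires. The exponent is then at most
    \<open>- 7 * m * l^2 = - 7 * a^2 / 64\<close>.\<close>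
  define l where "l = (i - m) / (8 * m)"
  have l: "0 < l" unfolding l_def d using m a by simp
  have l1: "l \<le> 1" unfolding l_def using True m by simp
  have "exp l \<le> 1 + l + l\<^sup>2" using l l1 exp_bound by simp
  then have "m * (exp l - 1) - l * i \<le> m * (l + l\<^sup>2) - l * i"
    using m by (intro diff_right_mono mult_left_mono) auto
  also have "\<dots> = m * l\<^sup>2 - l * (i - m)" by (simp add: algebra_simps)
  also have "i - m = 8 * m * l" unfolding l_def using m by simp
  also have "m * l\<^sup>2 - l * (8 * m * l) = - 7 * (m * l\<^sup>2)" by (simp add: power2_eq_square)
  also have "m * l\<^sup>2 = a\<^sup>2 / 64"
  proof -
    have "m * l\<^sup>2 = a\<^sup>2 * (m * (sqrt m)\<^sup>2) / (64 * m\<^sup>2)"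
      unfolding l_def d by (simp add: power_divide power_mult_distrib mult_ac)
    then show ?thesis using m by (simp add: power2_eq_square)
  qed
  also have "- 7 * (a\<^sup>2 / 64) \<le> - a\<^sup>2 / 16" by simp
  finally have "exp (m * (exp l - 1) - l * i) \<le> exp (- a\<^sup>2 / 16)" by simp
  also have "\<dots> \<le> exp (- a\<^sup>2 / 16) + exp (- sqrt a) + (if i \<le> sqrt a then 3 * i / a\<^sup>2 else 0)"
    using i by simp
  finally show ?thesis using l by blast
next
  case False
  \<comment> \<open>The exact minimiser of the exponent. The constant 9 is at least
    \<open>exp 2\<close>, whence \<open>l \<ge> 2\<close>.\<close>
  define l where "l = ln (i / m)"
  have im: "0 < i / m" using m i by simp
  have "exp 2 \<le> (9 :: real)"
    using power_mono[OF exp_le, of 2] by (simp flip: exp_of_nat_mult)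
  also have "9 \<le> i / m" using False m by (simp add: field_simps)
  finally have l2: "2 \<le> l" unfolding l_def using im by (simp add: ln_ge_iff)
  have "exp l = i / m" unfolding l_def using im by simp
  then have eq: "m * (exp l - 1) - l * i = i - m - l * i" using m by (simp add: field_simps)
  show ?thesis
  proof (cases "i \<le> sqrt a")
    case True
    have "i * (l - 1) \<ge> 1 * (l - 1)" using i l2 by (intro mult_right_mono) auto
    then have "i - m - l * i \<le> 1 - l" using m by (simp add: algebra_simps)
    then have "exp (m * (exp l - 1) - l * i) \<le> exp (1 - l)" unfolding eq by simp
    also have "\<dots> = exp 1 * (m / i)"
      unfolding exp_diff \<open>exp l = i / m\<close> by simp
    also have "\<dots> \<le> 3 * (i / a\<^sup>2)"
    proof (intro mult_mono exp_le)
      have "a * sqrt m \<le> i" using m by simp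
      then have "(a * sqrt m)\<^sup>2 \<le> i\<^sup>2" using a m by (intro power_mono) auto
      moreover have "(a * sqrt m)\<^sup>2 = a\<^sup>2 * m" using m by (simp add: power_mult_distrib)
      ultimately have "a\<^sup>2 * m \<le> i * i" by (simp only: power2_eq_square[of i])
      then show "m / i \<le> i / a\<^sup>2" using a i by (simp add: field_simps)
    qed (use m i in auto)
    also have "\<dots> \<le> exp (- a\<^sup>2 / 16) + exp (- sqrt a) + 3 * i / a\<^sup>2" by simp
    finally show ?thesis using True l2 by (intro exI[of _ l]) auto
  next
    case False
    have "l * i \<ge> 2 * i" using l2 i by (intro mult_right_mono) auto
    then have "i - m - l * i \<le> - sqrt a" using m False by linarith
    then have "exp (m * (exp l - 1) - l * i) \<le> exp (- sqrt a)" unfolding eq by simp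
    then have "exp (m * (exp l - 1) - l * i) \<le> exp (- a\<^sup>2 / 16) + exp (- sqrt a)"
      by (smt (verit) exp_gt_zero)
    then show ?thesis using False l2 by (intro exI[of _ l]) auto
  qed
qed

text \<open>A union bound over \<open>i\<close>, each event being that at least \<open>i\<close>
  P-values fall below a deterministic level. The exponential terms are summed over all
  \<open>N\<close> indices; the polynomial ones occur for at most \<open>sqrt a\<close> indices,
  each at most \<open>3 * sqrt a / a^2\<close>, and add up to \<open>3 / a\<close>.\<close>

lemma null_HC_tail:
  assumes \<gamma>: "0 < \<gamma>" "\<gamma> < 1" "1 \<le> \<gamma> * real N" and h: "0 < h"
  defines "a \<equiv> h * sqrt (1 - \<gamma>)" and "P \<equiv> \<Pi>\<^sub>M i\<in>{..<N}. gauss 0"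
  assumes a: "1 \<le> a"
  shows "measure P {z \<in> space P. HC \<gamma> N (\<lambda>i. pval (z i)) > h}
    \<le> real N * (exp (- a\<^sup>2 / 16) + exp (- sqrt a)) + 3 / a"
proof -
  interpret P: prob_space P unfolding P_def by (rule prob_space_PiM[OF prob_space_gauss])
  \<comment> \<open>The positive root of \<open>w\<^sup>2 + a * w = i\<close>: if the \<open>i\<close>-th term is large, the \<open>i\<close>-th
      order statistic lies below the deterministic level \<open>w\<^sup>2 / N\<close>.\<close>
  define w where "w i = (- a + sqrt (a\<^sup>2 + 4 * real i)) / 2" for i
  define A where "A i = {z. pval z \<le> (w i)\<^sup>2 / real N}" for i
  define E where "E i = {z \<in> space P. 1 * real i \<le> 1 * real (card {j. j < N \<and> z j \<in> A i})}" for i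
  have A: "A i \<in> sets borel" for i unfolding A_def by measurable
  have E: "E i \<in> sets P" for i
    unfolding E_def P_def using measurable_count[of "A i" "gauss 0" N] A by (auto intro!: borel_measurable_le)
  have Npos: "0 < real N" using \<gamma> by (cases N) auto
  have w_eq: "(w i)\<^sup>2 + a * w i = real i" for i
  proof -
    have "(sqrt (a\<^sup>2 + 4 * real i))\<^sup>2 = a\<^sup>2 + 4 * real i" by simp
    moreover have "2 * w i + a = sqrt (a\<^sup>2 + 4 * real i)" unfolding w_def by (simp add: field_simps)
    ultimately have "(2 * w i + a)\<^sup>2 = a\<^sup>2 + 4 * real i" by simp
    then show ?thesis by (simp add: power2_eq_square algebra_simps)
  qed
  have w_pos: "0 < w i" if "1 \<le> i" for i
  proof -
    have "sqrt (a\<^sup>2) < sqrt (a\<^sup>2 + 4 * real i)" using that by (intro real_sqrt_less_mono) simp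
    then show ?thesis unfolding w_def using a by simp
  qed
  define b where "b i = exp (- a\<^sup>2 / 16) + exp (- sqrt a) + (if real i \<le> sqrt a then 3 * real i / a\<^sup>2 else 0)" for i
  have bound: "measure P (E i) \<le> b i" if i: "1 \<le> i" for i
  proof -
    have "0 < (w i)\<^sup>2" "(w i)\<^sup>2 + a * sqrt ((w i)\<^sup>2) = real i"
      using w_pos[OF i] w_eq[of i] by simp_all
    from poisson_chernoff[OF this _ a] i obtain l where
      l: "0 < l" "exp ((w i)\<^sup>2 * (exp l - 1) - l * real i) \<le> b i"
      unfolding b_def by auto
    have "E i = {z \<in> space P. l * real i \<le> l * real (card {j. j < N \<and> z j \<in> A i})}"
      unfolding E_def using l(1) by simp
    then have "measure P (E i) \<le> exp (real N * measure (gauss 0) (A i) * (exp l - 1) - l * real i)"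
      unfolding P_def using chernoff_count[OF prob_space_gauss, of "A i" 0 N l "real i"] A by simp
    \<comment> \<open>Superuniformity bounds the mean count by \<open>(w i)^2\<close>; the exponent
      increases with the mean because \<open>l > 0\<close>.\<close>
    also have "real N * measure (gauss 0) (A i) \<le> real N * ((w i)\<^sup>2 / real N)"
      unfolding A_def by (intro mult_left_mono pval_superuniform) auto
    then have "exp (real N * measure (gauss 0) (A i) * (exp l - 1) - l * real i)
        \<le> exp ((w i)\<^sup>2 * (exp l - 1) - l * real i)"
      using l(1) Npos by (simp add: mult_right_mono)
    finally show ?thesis using l(2) by linarith
  qed
  have "{z \<in> space P. HC \<gamma> N (\<lambda>i. pval (z i)) > h} \<subseteq> (\<Union>i\<in>{1..N}. E i)"
  proof safe
    fix z assume z: "z \<in> space P" "HC \<gamma> N (\<lambda>i. pval (z i)) > h"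
    from HC_gt_imp[OF z(2) h \<gamma>(3,1,2)] pval_pos pval_le_1 obtain i x where
      ix: "1 \<le> i" "i \<le> N" "x = order_stat N (\<lambda>i. pval (z i)) i" "0 < x"
      "real i > real N * x + a * sqrt (real N * x)"
      unfolding a_def by metis
    define y where "y = sqrt (real N * x)"
    have y: "0 \<le> y" "y\<^sup>2 = real N * x" unfolding y_def using ix by simp_all
    \<comment> \<open>The map \<open>y^2 + a * y\<close> is increasing on nonnegative
      \<open>y\<close>, so the strict inequality passes to \<open>y < w i\<close>.\<close>
    have "y\<^sup>2 + a * y < (w i)\<^sup>2 + a * w i" using ix y w_eq[of i] unfolding y_def by simp
    moreover have "(w i)\<^sup>2 + a * w i \<le> y\<^sup>2 + a * y" if "w i \<le> y"
      using that w_pos[OF ix(1)] a y by (intro add_mono power_mono mult_left_mono) auto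
    ultimately have "y < w i" by force
    then have "y\<^sup>2 \<le> (w i)\<^sup>2" using y by (intro power_mono) auto
    then have "x \<le> (w i)\<^sup>2 / real N" using y Npos by (simp add: field_simps)
    then have "i \<le> card {j. j < N \<and> pval (z j) \<le> (w i)\<^sup>2 / real N}"
      using order_stat_le_iff ix by metis
    then have "z \<in> E i" unfolding E_def A_def using z by simp
    then show "z \<in> (\<Union>i\<in>{1..N}. E i)" using ix by auto
  qed
  then have "measure P {z \<in> space P. HC \<gamma> N (\<lambda>i. pval (z i)) > h} \<le> measure P (\<Union>i\<in>{1..N}. E i)"
    using E by (intro P.finite_measure_mono) auto
  also have "\<dots> \<le> (\<Sum>i\<in>{1..N}. measure P (E i))"
    using E by (intro measure_UNION_le) auto
  also have "\<dots> \<le> (\<Sum>i\<in>{1..N}. b i)"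
    using bound by (intro sum_mono) auto
  also have "\<dots> = real N * (exp (- a\<^sup>2 / 16) + exp (- sqrt a))
      + (\<Sum>i\<in>{1..N}. if real i \<le> sqrt a then 3 * real i / a\<^sup>2 else 0)"
    unfolding b_def by (simp add: sum.distrib algebra_simps)
  also have "(\<Sum>i\<in>{1..N}. if real i \<le> sqrt a then 3 * real i / a\<^sup>2 else 0)
      = (\<Sum>i\<in>{i\<in>{1..N}. real i \<le> sqrt a}. 3 * real i / a\<^sup>2)"
    by (rule sum.inter_filter[symmetric]) simp
  also have "\<dots> \<le> (\<Sum>i\<in>{i\<in>{1..N}. real i \<le> sqrt a}. 3 * sqrt a / a\<^sup>2)"
    by (intro sum_mono divide_right_mono) auto
  also have "\<dots> = real (card {i\<in>{1..N}. real i \<le> sqrt a}) * (3 * sqrt a / a\<^sup>2)" by simp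
  also have "\<dots> \<le> sqrt a * (3 * sqrt a / a\<^sup>2)"
  proof (rule mult_right_mono)
    have "{i\<in>{1..N}. real i \<le> sqrt a} \<subseteq> {1..nat \<lfloor>sqrt a\<rfloor>}" by (auto simp: le_nat_floor)
    then have "card {i\<in>{1..N}. real i \<le> sqrt a} \<le> nat \<lfloor>sqrt a\<rfloor>"
      using card_mono[of "{1..nat \<lfloor>sqrt a\<rfloor>}"] by fastforce
    then have "real (card {i\<in>{1..N}. real i \<le> sqrt a}) \<le> real (nat \<lfloor>sqrt a\<rfloor>)" by (rule of_nat_mono)
    also have "\<dots> \<le> sqrt a" using a by (intro of_nat_floor) simp
    finally show "real (card {i\<in>{1..N}. real i \<le> sqrt a}) \<le> sqrt a" .
  qed (use a in simp)
  also have "\<dots> = 3 / a" using a by (simp add: power2_eq_square field_simps)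
  finally show ?thesis by simp
qed

text \<open>\<open>(1 + x + x^2 / 2) * (1 - x + x^2 / 2) = 1 + x^4 / 4\<close>, and the first factor
  is at most \<open>exp x\<close>.\<close>

lemma exp_minus_le_quadratic:
  fixes x :: real
  assumes "0 \<le> x"
  shows "exp (- x) \<le> 1 - x + x\<^sup>2 / 2"
proof -
  have pos: "0 \<le> 1 - x + x\<^sup>2 / 2"
    using zero_le_power2[of "x - 1"] by (simp add: power2_eq_square algebra_simps)
  have "1 \<le> 1 + (x\<^sup>2 / 2)\<^sup>2" by simp
  also have "\<dots> = (1 + x + x\<^sup>2 / 2) * (1 - x + x\<^sup>2 / 2)"
    by (simp add: power2_eq_square field_simps)
  also have "\<dots> \<le> exp x * (1 - x + x\<^sup>2 / 2)"
    using exp_lower_Taylor_quadratic[OF assms] pos by (rule mult_right_mono)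
  finally show ?thesis by (simp add: exp_minus field_simps)
qed

text \<open>One level \<open>z0\<close> suffices: \<open>\<tau>\<close> is the null mean of the
  number of \<open>\<bar>z\<bar>\<close> above it, and \<open>b\<close> a lower bound for the
  increase of this mean under the mixture. Since \<open>b\<close> dominates
  \<open>h * sqrt \<tau>\<close> and \<open>h\<close>, a lower Chernoff bound keeps the count above
  the threshold. The assumption \<open>room\<close> keeps the index of the term used within
  \<open>\<gamma> * real N\<close>.\<close>

lemma alt_HC_tail:
  fixes N :: nat and m :: real
  assumes \<gamma>: "\<gamma> < 1" and e: "0 \<le> e" "e \<le> 1" and z0: "0 \<le> z0" "pval z0 < 1" and h: "1 \<le> h"
  defines "\<tau> \<equiv> real N * pval z0" and "P \<equiv> \<Pi>\<^sub>M i\<in>{..<N}. mixture e m 0"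
    and "b \<equiv> real N * e * (measure (gauss m) {z0..} - pval z0)"
  assumes room: "\<tau> + h * sqrt \<tau> + 2 \<le> \<gamma> * real N"
    and b: "8 * h * sqrt \<tau> \<le> b" "8 * h \<le> b"
  shows "measure P {z \<in> space P. HC \<gamma> N (\<lambda>i. pval (z i)) \<le> h} \<le> exp (- h / 2)"
proof -
  have pW: "prob_space (mixture e m 0)" using e by (rule prob_space_mixture)
  interpret P: prob_space P unfolding P_def by (rule prob_space_PiM[OF pW])
  interpret G: prob_space "gauss c" for c by (rule prob_space_gauss)
  define U where "U = {z :: real. z0 \<le> \<bar>z\<bar>}"
  have U: "U \<in> sets borel" unfolding U_def by simp
  define p where "p = measure (mixture e m 0) U"
  \<comment> \<open>Average tail mass of the two shifted components; by reflection each is at least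
    the one-sided tail entering \<open>b\<close>.\<close>
  define g where "g = (measure (gauss m) U + measure (gauss (- m)) U) / 2"
  have t: "measure (gauss 0) U = pval z0" unfolding U_def pval_def using z0 by simp
  have "measure (gauss m) {z0..} \<le> measure (gauss m) U"
    unfolding U_def by (intro G.finite_measure_mono) auto
  moreover have "measure (gauss m) {z0..} \<le> measure (gauss (- m)) U"
  proof -
    have "measure (gauss m) {z0..} = measure (gauss (- m)) {..- z0}"
      using gauss_reflect[of "- m" "- z0"] by simp
    also have "\<dots> \<le> measure (gauss (- m)) U"
      unfolding U_def by (intro G.finite_measure_mono) auto
    finally show ?thesis .
  qed
  ultimately have g: "measure (gauss m) {z0..} \<le> g" unfolding g_def by simp
  define B where "B = real N * e * (g - pval z0)"
  have bB: "b \<le> B" unfolding b_def B_def using g e by (intro mult_left_mono) auto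
  have Np: "real N * p = \<tau> + B"
    unfolding p_def B_def \<tau>_def measure_mixture[OF e U] g_def by (simp add: t algebra_simps)
  have N: "0 < real N" using b h unfolding b_def by (cases N) auto
  have \<tau>: "0 < \<tau>" unfolding \<tau>_def using N pval_pos by simp
  have B: "8 * h * sqrt \<tau> \<le> B" "8 * h \<le> B" using b bB by auto
  have B0: "0 < B" using B h by linarith
  define k where "k = \<tau> + h * sqrt \<tau> + 2"
  define v where "v = real N * p - k"
  \<comment> \<open>\<open>h * sqrt \<tau> \<le> B / 8\<close>, and
    \<open>2 \<le> 2 * h \<le> B / 4\<close>.\<close>
  have v: "B / 2 \<le> v" unfolding v_def k_def Np using B h by simp
  \<comment> \<open>Minimiser of the quadratic bound
    \<open>(\<tau> + B) * \<theta>^2 / 2 - \<theta> * v\<close> on the exponent, with value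
    \<open>- v^2 / (2 * (\<tau> + B))\<close>.\<close>
  define \<theta> where "\<theta> = v / (\<tau> + B)"
  have \<theta>: "0 < \<theta>" unfolding \<theta>_def using v B0 \<tau> by simp
  \<comment> \<open>The added 1 makes \<open>K\<close> strictly larger than
    \<open>\<tau> + h * sqrt \<tau>\<close>; the 2 in \<open>k\<close> pays for it and for the
    rounding.\<close>
  define K where "K = nat \<lceil>\<tau> + h * sqrt \<tau>\<rceil> + 1"
  have pos: "0 \<le> \<tau> + h * sqrt \<tau>" using \<tau> h by simp
  have K: "real K > \<tau> + h * sqrt \<tau>" "real K \<le> k" unfolding K_def k_def using pos by linarith+
  have "{z \<in> space P. HC \<gamma> N (\<lambda>i. pval (z i)) \<le> h}
      \<subseteq> {z \<in> space P. - \<theta> * k \<le> - \<theta> * real (card {j. j < N \<and> z j \<in> U})}"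
  proof safe
    fix z assume z: "z \<in> space P" "HC \<gamma> N (\<lambda>i. pval (z i)) \<le> h"
    have "\<not> K \<le> card {j. j < N \<and> pval (z j) \<le> pval z0}"
    proof
      assume *: "K \<le> card {j. j < N \<and> pval (z j) \<le> pval z0}"
      have "HC \<gamma> N (\<lambda>i. pval (z i)) > h"
        by (rule HC_gt_of_count[OF pval_pos z0(2) _ _ \<gamma> _ _ pval_pos *])
          (use K room h in \<open>auto simp: K_def k_def \<tau>_def\<close>)
      then show False using z(2) by simp
    qed
    moreover have "card {j. j < N \<and> z j \<in> U} \<le> card {j. j < N \<and> pval (z j) \<le> pval z0}"
      using z0 unfolding U_def by (intro card_mono) (auto intro: pval_antimono)
    ultimately have "real (card {j. j < N \<and> z j \<in> U}) \<le> k" using K by linarith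
    then show "- \<theta> * k \<le> - \<theta> * real (card {j. j < N \<and> z j \<in> U})" using \<theta> by simp
  qed
  moreover have "{z \<in> space P. - \<theta> * k \<le> - \<theta> * real (card {j. j < N \<and> z j \<in> U})} \<in> sets P"
    unfolding P_def using measurable_count[of U "mixture e m 0" N] U by (auto intro!: borel_measurable_le)
  ultimately have "measure P {z \<in> space P. HC \<gamma> N (\<lambda>i. pval (z i)) \<le> h}
      \<le> measure P {z \<in> space P. - \<theta> * k \<le> - \<theta> * real (card {j. j < N \<and> z j \<in> U})}"
    by (rule P.finite_measure_mono)
  also have "\<dots> \<le> exp (real N * p * (exp (- \<theta>) - 1) - - \<theta> * k)"
    unfolding P_def p_def using U by (intro chernoff_count[OF pW]) simp
  also have "\<dots> \<le> exp (- h / 2)"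
  proof -
    have "real N * p * (exp (- \<theta>) - 1) \<le> real N * p * (- \<theta> + \<theta>\<^sup>2 / 2)"
      using exp_minus_le_quadratic[of \<theta>] \<theta> \<tau> B0 unfolding Np by (intro mult_left_mono) auto
    then have "real N * p * (exp (- \<theta>) - 1) - - \<theta> * k \<le> (\<tau> + B) * \<theta>\<^sup>2 / 2 - \<theta> * v"
      unfolding v_def Np by (simp add: algebra_simps add_divide_distrib)
    also have "\<dots> = - (v\<^sup>2 / (2 * (\<tau> + B)))"
    proof -
      have "w * (v / w)\<^sup>2 / 2 - v / w * v = - (v\<^sup>2 / (2 * w))" if "0 < w" for w
        using that by (simp add: power2_eq_square field_simps)
      then show ?thesis unfolding \<theta>_def using \<tau> B0 by simp
    qed
    finally have "real N * p * (exp (- \<theta>) - 1) - - \<theta> * k \<le> - (v\<^sup>2 / (2 * (\<tau> + B)))" .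
    moreover have "h / 2 \<le> v\<^sup>2 / (2 * (\<tau> + B))"
    proof -
      have "(B / 2)\<^sup>2 \<le> v\<^sup>2" using v B0 by (intro power_mono) auto
      then have v2: "B\<^sup>2 / 4 \<le> v\<^sup>2" by (simp add: power_divide)
      have "4 * h * (\<tau> + B) \<le> B\<^sup>2"
      proof -
        have "(8 * h * sqrt \<tau>)\<^sup>2 \<le> B\<^sup>2" using B h \<tau> by (intro power_mono) auto
        moreover have "(8 * h * sqrt \<tau>)\<^sup>2 = 64 * (h * h) * \<tau>"
          using \<tau> by (simp add: power_mult_distrib power2_eq_square[of h])
        ultimately have "64 * (h * h) * \<tau> \<le> B\<^sup>2" by simp
        moreover have "h * \<tau> \<le> (h * h) * \<tau>" using h \<tau> by (intro mult_right_mono) auto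
        moreover have "8 * h * B \<le> B\<^sup>2" using B B0 unfolding power2_eq_square by (intro mult_right_mono) auto
        ultimately have "4 * (h * \<tau>) + 4 * (h * B) \<le> B\<^sup>2"
          using zero_le_power2[of B] by linarith
        then show ?thesis by (simp add: algebra_simps)
      qed
      then have "h * (\<tau> + B) \<le> v\<^sup>2" using v2 by linarith
      then show ?thesis using \<tau> B0 by (simp add: field_simps)
    qed
    ultimately show ?thesis by simp
  qed
  finally show ?thesis .
qed

subsection \<open>Hellinger distance of products\<close>

text \<open>The product measure is determined by its values on boxes, where density and indicator
  both factor and the integral splits.\<close>

lemma PiM_density_const:
  fixes Q :: "'a measure" and l :: "'a \<Rightarrow> real" and N :: nat
  assumes Q: "prob_space Q" and Q': "prob_space (density Q l)"
    and l [measurable]: "l \<in> borel_measurable Q" and l0: "\<And>x. 0 \<le> l x"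
  shows "(\<Pi>\<^sub>M i\<in>{..<N}. density Q l) = density (\<Pi>\<^sub>M i\<in>{..<N}. Q) (\<lambda>\<omega>. ennreal (\<Prod>i<N. l (\<omega> i)))"
proof -
  interpret Q: prob_space Q by fact
  interpret Q': prob_space "density Q l" by fact
  interpret P: product_sigma_finite "\<lambda>_ :: nat. Q" by standard
  interpret P': product_sigma_finite "\<lambda>_ :: nat. density Q l" by standard
  let ?P = "\<Pi>\<^sub>M i\<in>{..<N}. Q"
  have L [measurable]: "(\<lambda>\<omega>. ennreal (\<Prod>i<N. l (\<omega> i))) \<in> borel_measurable ?P" by measurable
  show ?thesis
  proof (rule sym, rule P'.PiM_eqI)
    show "sets (density ?P (\<lambda>\<omega>. ennreal (\<Prod>i<N. l (\<omega> i)))) = sets (\<Pi>\<^sub>M i\<in>{..<N}. density Q l)"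
      by (simp cong: sets_PiM_cong)
    fix A :: "nat \<Rightarrow> 'a set" assume A: "\<And>i. i \<in> {..<N} \<Longrightarrow> A i \<in> sets (density Q l)"
    then have A' [measurable]: "A i \<in> sets Q" if "i < N" for i using that by simp
    have PA: "Pi\<^sub>E {..<N} A \<in> sets ?P" using A by (intro sets_PiM_I_finite) auto
    have "emeasure (density ?P (\<lambda>\<omega>. ennreal (\<Prod>i<N. l (\<omega> i)))) (Pi\<^sub>E {..<N} A)
        = (\<integral>\<^sup>+\<omega>. ennreal (\<Prod>i<N. l (\<omega> i)) * indicator (Pi\<^sub>E {..<N} A) \<omega> \<partial>?P)"
      using PA by (intro emeasure_density) auto
    also have "\<dots> = (\<integral>\<^sup>+\<omega>. (\<Prod>i<N. ennreal (l (\<omega> i)) * indicator (A i) (\<omega> i)) \<partial>?P)"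
    proof (intro nn_integral_cong)
      fix \<omega> assume "\<omega> \<in> space ?P"
      then have "indicator (Pi\<^sub>E {..<N} A) \<omega> = (\<Prod>i<N. indicator (A i) (\<omega> i) :: ennreal)"
        by (auto simp: indicator_def space_PiM PiE_def Pi_def intro!: prod.neutral[symmetric] prod_zero[symmetric])
      then show "ennreal (\<Prod>i<N. l (\<omega> i)) * indicator (Pi\<^sub>E {..<N} A) \<omega>
          = (\<Prod>i<N. ennreal (l (\<omega> i)) * indicator (A i) (\<omega> i))"
        using l0 by (simp add: prod.distrib prod_ennreal)
    qed
    also have "\<dots> = (\<Prod>i<N. \<integral>\<^sup>+x. ennreal (l x) * indicator (A i) x \<partial>Q)"
      by (intro P.product_nn_integral_prod) auto
    also have "\<dots> = (\<Prod>i\<in>{..<N}. emeasure (density Q l) (A i))"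
      by (intro prod.cong) (auto simp: emeasure_density)
    finally show "emeasure (density ?P (\<lambda>\<omega>. ennreal (\<Prod>i<N. l (\<omega> i)))) (Pi\<^sub>E {..<N} A)
        = (\<Prod>i\<in>{..<N}. emeasure (density Q l) (A i))" .
  qed simp
qed

lemma (in finite_measure) integrable_sqrt:
  fixes f :: "'a \<Rightarrow> real"
  assumes "integrable M f" "\<And>x. 0 \<le> f x"
  shows "integrable M (\<lambda>x. sqrt (f x))"
proof (rule Bochner_Integration.integrable_bound)
  show "integrable M (\<lambda>x. 1 + f x)" using assms by simp
  have "sqrt y \<le> 1 + y" if "0 \<le> y" for y :: real
    using that arith_geo_mean_sqrt[of 1 y] by simp
  then show "AE x in M. norm (sqrt (f x)) \<le> norm (1 + f x)" using assms by simp
  show "(\<lambda>x. sqrt (f x)) \<in> borel_measurable M" using assms by simp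
qed

text \<open>Total variation is bounded through the Hellinger affinity \<open>S\<close>, the integral
  of \<open>sqrt l\<close>. Integrating a weighted AM-GM bound for \<open>\<bar>l - 1\<bar>\<close>
  gives \<open>c * (1 - S) + (1 + S) / c\<close>, where \<open>S \<le> 1\<close>.\<close>

lemma (in prob_space) abs_measure_density_diff_le:
  assumes l [measurable]: "l \<in> borel_measurable M" and l0: "\<And>x. 0 \<le> l x"
    and l1: "integrable M l" "integral\<^sup>L M l = 1"
    and A: "A \<in> sets M" and D: "0 < D" "1 - (\<integral>x. sqrt (l x) \<partial>M) \<le> D"
  shows "\<bar>measure (density M l) A - measure M A\<bar> \<le> 3 * sqrt D"
proof -
  have int_sqrt: "integrable M (\<lambda>x. sqrt (l x))" using l1(1) l0 by (rule integrable_sqrt)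
  have iA: "integrable M (\<lambda>x. l x * indicator A x)" "integrable M (\<lambda>x. indicator A x :: real)"
    using integrable_real_mult_indicator[OF A l1(1)] A by (auto simp: emeasure_eq_measure)
  have m: "measure (density M l) A = (\<integral>x. l x * indicator A x \<partial>M)"
  proof -
    have "emeasure (density M l) A = (\<integral>\<^sup>+x. ennreal (l x * indicator A x) \<partial>M)"
      using A by (subst emeasure_density) (auto intro!: nn_integral_cong simp: indicator_def)
    also have "\<dots> = ennreal (\<integral>x. l x * indicator A x \<partial>M)"
      using l0 iA(1) by (intro nn_integral_eq_integral) auto
    finally show ?thesis using l0 by (simp add: measure_def)
  qed
  have sq_le: "sqrt y \<le> (1 + y) / 2" if "0 \<le> y" for y :: real
    using that arith_geo_mean_sqrt[of 1 y] by simp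
  have "(\<integral>x. sqrt (l x) \<partial>M) \<le> (\<integral>x. (1 + l x) / 2 \<partial>M)"
    using int_sqrt l1 l0 sq_le by (intro integral_mono) auto
  also have "\<dots> = 1" using l1 by (simp add: prob_space)
  finally have S1: "(\<integral>x. sqrt (l x) \<partial>M) \<le> 1" .
  \<comment> \<open>With this weight \<open>c * D + 2 / c\<close> equals
    \<open>3 * sqrt D\<close>.\<close>
  define c where "c = 1 / sqrt D"
  have c: "0 < c" unfolding c_def using D by simp
  \<comment> \<open>AM-GM with weight \<open>c\<close>, applied to the factorisation
      \<open>y - 1 = (sqrt y - 1) * (sqrt y + 1)\<close>.\<close>
  have amgm: "\<bar>y - 1\<bar> \<le> c / 2 * (y - 2 * sqrt y + 1) + 1 / (2 * c) * (y + 2 * sqrt y + 1)"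
    if "0 \<le> y" for y
  proof -
    define u v where "u = sqrt y - 1" and "v = sqrt y + 1"
    have y: "y = (sqrt y)\<^sup>2" using that by simp
    have "0 \<le> (c * \<bar>u\<bar> - \<bar>v\<bar>)\<^sup>2 / (2 * c)" using c by simp
    also have "\<dots> = c / 2 * u\<^sup>2 + 1 / (2 * c) * v\<^sup>2 - \<bar>u\<bar> * \<bar>v\<bar>"
      using c by (simp add: power2_eq_square field_simps)
    finally have "\<bar>u * v\<bar> \<le> c / 2 * u\<^sup>2 + 1 / (2 * c) * v\<^sup>2" by (simp add: abs_mult)
    moreover have "u * v = y - 1" "u\<^sup>2 = y - 2 * sqrt y + 1" "v\<^sup>2 = y + 2 * sqrt y + 1"
      using y unfolding u_def v_def by (simp_all add: power2_eq_square algebra_simps)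
    ultimately show ?thesis by simp
  qed
  have "measure (density M l) A - measure M A = (\<integral>x. l x * indicator A x - indicator A x \<partial>M)"
    using iA A by (subst Bochner_Integration.integral_diff) (auto simp: m)
  also have "\<bar>\<dots>\<bar> \<le> (\<integral>x. \<bar>l x * indicator A x - indicator A x\<bar> \<partial>M)"
    by (rule integral_abs_bound)
  also have "\<dots> \<le> (\<integral>x. c / 2 * (l x - 2 * sqrt (l x) + 1) + 1 / (2 * c) * (l x + 2 * sqrt (l x) + 1) \<partial>M)"
  proof (rule integral_mono)
    show "integrable M (\<lambda>x. \<bar>l x * indicator A x - indicator A x\<bar>)"
      using iA by (intro integrable_abs Bochner_Integration.integrable_diff) auto
    show "integrable M (\<lambda>x. c / 2 * (l x - 2 * sqrt (l x) + 1) + 1 / (2 * c) * (l x + 2 * sqrt (l x) + 1))"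
      using l1 int_sqrt
      by (intro Bochner_Integration.integrable_add Bochner_Integration.integrable_diff integrable_mult_right) auto
    fix x
    have "\<bar>l x * indicator A x - indicator A x\<bar> \<le> \<bar>l x - 1\<bar>" by (simp add: indicator_def)
    then show "\<bar>l x * indicator A x - indicator A x\<bar>
        \<le> c / 2 * (l x - 2 * sqrt (l x) + 1) + 1 / (2 * c) * (l x + 2 * sqrt (l x) + 1)"
      using amgm[OF l0[of x]] by linarith
  qed
  also have "\<dots> = c * (1 - (\<integral>x. sqrt (l x) \<partial>M)) + 1 / c * (1 + (\<integral>x. sqrt (l x) \<partial>M))"
    using l1 int_sqrt c by (simp add: prob_space) (simp add: field_simps)
  also have "\<dots> \<le> c * D + 1 / c * 2"
    using c D S1 by (intro add_mono mult_left_mono) auto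
  also have "\<dots> = 3 * sqrt D"
    unfolding c_def using D by (simp add: real_div_sqrt)
  finally show ?thesis .
qed

lemma sqrt_prod: "sqrt (\<Prod>i\<in>I. f i) = (\<Prod>i\<in>I. sqrt (f i))"
  by (induction I rule: infinite_finite_induct) (auto simp: real_sqrt_mult)

text \<open>The affinity is multiplicative, so that of the product is \<open>s ^ N\<close>, and the
  Bernoulli inequality gives \<open>1 - s ^ N \<le> N * (1 - s)\<close>. The integral bounded by
  \<open>B\<close> equals \<open>2 * (1 - s)\<close>, which explains the factor in
  \<open>2 * D\<close>.\<close>

lemma abs_measure_PiM_density_diff_le:
  fixes Q :: "'a measure" and l :: "'a \<Rightarrow> real" and N :: nat
  assumes Q: "prob_space Q" and Q': "prob_space (density Q l)"
    and l [measurable]: "l \<in> borel_measurable Q" and l0: "\<And>x. 0 \<le> l x"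
    and A: "A \<in> sets (\<Pi>\<^sub>M i\<in>{..<N}. Q)"
    and B: "(\<integral>\<^sup>+x. ennreal ((sqrt (l x) - 1)\<^sup>2) \<partial>Q) \<le> ennreal B" "0 \<le> B" "real N * B \<le> 2 * D" "0 < D"
  shows "\<bar>measure (\<Pi>\<^sub>M i\<in>{..<N}. density Q l) A - measure (\<Pi>\<^sub>M i\<in>{..<N}. Q) A\<bar> \<le> 3 * sqrt D"
proof -
  interpret Q: prob_space Q by fact
  interpret Q': prob_space "density Q l" by fact
  interpret P: product_sigma_finite "\<lambda>_ :: nat. Q" by standard
  let ?P = "\<Pi>\<^sub>M i\<in>{..<N}. Q"
  interpret PP: prob_space ?P by (rule prob_space_PiM[OF Q])
  have "(\<integral>\<^sup>+x. ennreal (l x) \<partial>Q) = emeasure (density Q l) (space (density Q l))"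
    by (simp add: emeasure_density)
  then have nn1: "(\<integral>\<^sup>+x. ennreal (l x) \<partial>Q) = 1" by (simp only: Q'.emeasure_space_1)
  have int_l: "integrable Q l" using nn1 l0 by (intro integrableI_nonneg) auto
  have one: "integral\<^sup>L Q l = 1" using nn1 l0 by (subst integral_eq_nn_integral) auto
  have int_sqrt: "integrable Q (\<lambda>x. sqrt (l x))" using int_l l0 by (rule Q.integrable_sqrt)
  define s where "s = (\<integral>x. sqrt (l x) \<partial>Q)"
  have sq: "(sqrt (l x) - 1)\<^sup>2 = l x - 2 * sqrt (l x) + 1" for x
    using l0[of x] by (simp add: power2_eq_square algebra_simps)
  have int_sq: "integrable Q (\<lambda>x. (sqrt (l x) - 1)\<^sup>2)"
    unfolding sq using int_l int_sqrt by simp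
  have "(\<integral>x. (sqrt (l x) - 1)\<^sup>2 \<partial>Q) \<le> B"
    using B int_sq by (subst (asm) nn_integral_eq_integral) auto
  moreover have "(\<integral>x. (sqrt (l x) - 1)\<^sup>2 \<partial>Q) = 2 * (1 - s)"
    unfolding sq s_def using int_l int_sqrt one by (simp add: Q.prob_space)
  ultimately have s: "1 - s \<le> B / 2" by simp
  have s0: "0 \<le> s" unfolding s_def by (rule Bochner_Integration.integral_nonneg) (simp add: l0)
  have "1 + real N * (s - 1) \<le> (1 + (s - 1)) ^ N" using s0 by (intro Bernoulli_inequality) simp
  then have bern: "1 - s ^ N \<le> real N * (1 - s)" by (simp add: algebra_simps)
  have "real N * (1 - s) \<le> real N * (B / 2)" using s by (intro mult_left_mono) auto
  then have sN: "1 - s ^ N \<le> D" using bern B by simp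
  have "\<bar>measure (density ?P (\<lambda>\<omega>. ennreal (\<Prod>i<N. l (\<omega> i)))) A - measure ?P A\<bar> \<le> 3 * sqrt D"
  proof (rule PP.abs_measure_density_diff_le)
    show "integrable ?P (\<lambda>\<omega>. \<Prod>i<N. l (\<omega> i))"
      using int_l by (intro P.product_integrable_prod) auto
    show "(\<integral>\<omega>. (\<Prod>i<N. l (\<omega> i)) \<partial>?P) = 1"
      using int_l one by (subst P.product_integral_prod) auto
    have "(\<integral>\<omega>. sqrt (\<Prod>i<N. l (\<omega> i)) \<partial>?P) = (\<integral>\<omega>. (\<Prod>i<N. sqrt (l (\<omega> i))) \<partial>?P)"
      by (simp add: sqrt_prod)
    also have "\<dots> = s ^ N" unfolding s_def using int_sqrt by (subst P.product_integral_prod) auto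
    finally show "1 - (\<integral>\<omega>. sqrt (\<Prod>i<N. l (\<omega> i)) \<partial>?P) \<le> D" using sN by simp
  qed (use A B l0 in \<open>auto intro!: prod_nonneg\<close>)
  then show ?thesis using PiM_density_const[OF Q Q' l l0] by simp
qed

section \<open>Hellinger distance between the mixture and the standard normal law\<close>

lemma has_bochner_integral_gauss:
  assumes B: "B \<in> sets borel"
  shows "has_bochner_integral lborel (\<lambda>z. normal_density c 1 z * indicator B z) (measure (gauss c) B)"
proof -
  interpret G: prob_space "gauss c" by (rule prob_space_gauss)
  have "emeasure (gauss c) B = (\<integral>\<^sup>+z. ennreal (normal_density c 1 z * indicator B z) \<partial>lborel)"
    using B by (subst emeasure_density) (auto intro!: nn_integral_cong simp: indicator_def)
  then have "(\<integral>\<^sup>+z. ennreal (normal_density c 1 z * indicator B z) \<partial>lborel) = ennreal (measure (gauss c) B)"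
    by (simp add: G.emeasure_eq_measure)
  then show ?thesis using B by (intro has_bochner_integral_nn_integral) auto
qed

text \<open>From \<open>\<bar>y - 1\<bar> = \<bar>sqrt y - 1\<bar> * (sqrt y + 1)\<close>, whose
  last factor is at least 1 and at least \<open>\<bar>sqrt y - 1\<bar>\<close>. The two bounds lead
  to second and first moments of the likelihood ratio.\<close>

lemma sqrt_minus_one_sq_le:
  fixes y :: real
  assumes "0 \<le> y"
  shows "(sqrt y - 1)\<^sup>2 \<le> (y - 1)\<^sup>2" "(sqrt y - 1)\<^sup>2 \<le> \<bar>y - 1\<bar>"
proof -
  have eq: "\<bar>y - 1\<bar> = \<bar>sqrt y - 1\<bar> * (sqrt y + 1)"
  proof -
    have "y - 1 = (sqrt y - 1) * (sqrt y + 1)" using assms by (simp add: algebra_simps)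
    then have "\<bar>y - 1\<bar> = \<bar>sqrt y - 1\<bar> * \<bar>sqrt y + 1\<bar>" by (metis abs_mult)
    then show ?thesis using assms by simp
  qed
  have "\<bar>sqrt y - 1\<bar> * 1 \<le> \<bar>sqrt y - 1\<bar> * (sqrt y + 1)" using assms by (intro mult_left_mono) auto
  then show "(sqrt y - 1)\<^sup>2 \<le> (y - 1)\<^sup>2" by (subst abs_le_square_iff[symmetric]) (simp add: eq)
  have "\<bar>sqrt y - 1\<bar> * \<bar>sqrt y - 1\<bar> \<le> \<bar>sqrt y - 1\<bar> * (sqrt y + 1)"
    using real_sqrt_ge_zero[OF assms] by (intro mult_left_mono) (simp_all add: abs_if)
  then show "(sqrt y - 1)\<^sup>2 \<le> \<bar>y - 1\<bar>" by (simp add: eq power2_eq_square flip: abs_mult)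
qed

text \<open>Completing the square. Second moments thus become Gaussian masses centred at
  \<open>2 * m\<close>, and truncation at \<open>a\<close> pays off when
  \<open>2 * m > a\<close>.\<close>

lemma normal_density_sq_ratio:
  "(normal_density m 1 z)\<^sup>2 / normal_density 0 1 z = exp (m\<^sup>2) * normal_density (2 * m) 1 z"
proof -
  have "(exp (- (z - m)\<^sup>2 / 2))\<^sup>2 = exp (m\<^sup>2) * exp (- (z - 2 * m)\<^sup>2 / 2) * exp (- z\<^sup>2 / 2)"
    by (simp add: power2_eq_square algebra_simps add_divide_distrib diff_divide_distrib flip: exp_add)
  then show ?thesis by (simp add: normal_density_def field_simps power2_eq_square)
qed

text \<open>The second moment of the likelihood ratio is only used on \<open>\<bar>z\<bar> \<le> a\<close>; beyond \<open>a\<close>, where it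
  would be dominated by rare large values, the first moment suffices.\<close>

lemma hellinger_mixture_le:
  assumes e: "0 \<le> e" "e \<le> 1" and m: "0 \<le> m" and a: "0 \<le> a"
  shows "(\<integral>\<^sup>+z. ennreal ((sqrt (mix_density e m 0 z / normal_density 0 1 z) - 1)\<^sup>2) \<partial>gauss 0)
    \<le> ennreal (e\<^sup>2 * (1 + exp (m\<^sup>2 - (max 0 (2 * m - a))\<^sup>2 / 2)) + 4 * e * exp (- (max 0 (a - m))\<^sup>2 / 2))"
proof -
  define g where "g k B z = normal_density k 1 z * indicat_real B z" for k B z
  define T where "T = {z :: real. a \<le> \<bar>z\<bar>}"
  define K where "K = e\<^sup>2 / 2 * exp (m\<^sup>2)"
  \<comment> \<open>A majorant with explicit integral \<open>V\<close>: the first three summands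
    serve \<open>\<bar>z\<bar> \<le> a\<close>, the last three serve \<open>T\<close>. The interval
    is enlarged to the half-line facing away from each centre, so that the one-sided tail bounds
    apply.\<close>
  define F where "F z = e\<^sup>2 * g 0 UNIV z + K * g (2 * m) {..a} z + K * g (- 2 * m) {- a..} z
      + e * g 0 T z + e / 2 * g m T z + e / 2 * g (- m) T z" for z
  define V where "V = e\<^sup>2 * measure (gauss 0) UNIV + K * measure (gauss (2 * m)) {..a}
      + K * measure (gauss (- 2 * m)) {- a..} + e * measure (gauss 0) T
      + e / 2 * measure (gauss m) T + e / 2 * measure (gauss (- m)) T"
  have T: "T \<in> sets borel" unfolding T_def by simp
  have g0: "0 \<le> g k B z" for k B z unfolding g_def by simp
  have K0: "0 \<le> K" unfolding K_def by simp
  have FV: "has_bochner_integral lborel F V"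
    unfolding F_def[abs_def] V_def g_def using T
    by (intro has_bochner_integral_add has_bochner_integral_mult_right has_bochner_integral_gauss) auto
  have pointwise: "normal_density 0 1 z * (sqrt (mix_density e m 0 z / normal_density 0 1 z) - 1)\<^sup>2 \<le> F z" for z
  proof -
    define p where "p = normal_density 0 1 z"
    define u v where "u = normal_density m 1 z" and "v = normal_density (- m) 1 z"
    \<comment> \<open>Likelihood ratio of the pure signal, the symmetric two-point mixture, against
      the standard normal; the full ratio is \<open>1 + e * (L - 1)\<close>.\<close>
    define L where "L = (u + v) / (2 * p)"
    have p: "0 < p" unfolding p_def by (rule normal_density_pos) simp
    have uv: "0 \<le> u" "0 \<le> v" unfolding u_def v_def by simp_all
    have L0: "0 \<le> L" unfolding L_def using p uv by simp
    define y where "y = mix_density e m 0 z / normal_density 0 1 z"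
    have y: "y = 1 + e * (L - 1)"
      unfolding y_def mix_density_def L_def using p by (simp add: u_def v_def p_def field_simps)
    have "0 \<le> (1 - e) + e * L" using e L0 by simp
    then have y0: "0 \<le> y" unfolding y by (simp add: algebra_simps)
    have pL: "p * L = (u + v) / 2" unfolding L_def using p by simp
    show ?thesis
    proof (cases "\<bar>z\<bar> \<le> a")
      case True
      have "p * (sqrt y - 1)\<^sup>2 \<le> p * (y - 1)\<^sup>2"
        using p y0 by (intro mult_left_mono sqrt_minus_one_sq_le) auto
      also have "\<dots> = e\<^sup>2 * (p * (L - 1)\<^sup>2)" unfolding y by (simp add: power_mult_distrib)
      also have "\<dots> \<le> e\<^sup>2 * (p * (1 + L\<^sup>2))"
        using p L0 by (intro mult_left_mono) (auto simp: power2_eq_square algebra_simps)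
      also have "p * (1 + L\<^sup>2) = p + (u + v)\<^sup>2 / (4 * p)"
        unfolding L_def using p by (simp add: power2_eq_square field_simps)
      also have "e\<^sup>2 * (p + (u + v)\<^sup>2 / (4 * p)) \<le> e\<^sup>2 * (p + (2 * u\<^sup>2 + 2 * v\<^sup>2) / (4 * p))"
        using p sum_squares_bound[of u v]
        by (intro mult_left_mono add_left_mono divide_right_mono) (auto simp: power2_sum)
      also have "(2 * u\<^sup>2 + 2 * v\<^sup>2) / (4 * p) = (u\<^sup>2 / p + v\<^sup>2 / p) / 2"
        using p by (simp add: field_simps)
      also have "u\<^sup>2 / p = exp (m\<^sup>2) * g (2 * m) {..a} z"
        unfolding u_def p_def normal_density_sq_ratio g_def using True by simp
      also have "v\<^sup>2 / p = exp (m\<^sup>2) * g (- 2 * m) {- a..} z"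
        unfolding v_def p_def normal_density_sq_ratio g_def using True by simp
      also have "e\<^sup>2 * (p + (exp (m\<^sup>2) * g (2 * m) {..a} z + exp (m\<^sup>2) * g (- 2 * m) {- a..} z) / 2)
          = e\<^sup>2 * g 0 UNIV z + K * g (2 * m) {..a} z + K * g (- 2 * m) {- a..} z"
        unfolding K_def by (simp add: algebra_simps g_def p_def)
      also have "\<dots> \<le> F z" unfolding F_def using e g0 by simp
      finally show ?thesis unfolding y_def p_def .
    next
      case False
      then have zT: "z \<in> T" unfolding T_def by simp
      have "p * (sqrt y - 1)\<^sup>2 \<le> p * \<bar>y - 1\<bar>"
        using p y0 by (intro mult_left_mono sqrt_minus_one_sq_le) auto
      also have "\<dots> = e * (p * \<bar>L - 1\<bar>)" unfolding y using e by (simp add: abs_mult)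
      also have "\<dots> \<le> e * (p * (1 + L))" using e p L0 by (intro mult_left_mono) auto
      also have "\<dots> = e * g 0 T z + e / 2 * g m T z + e / 2 * g (- m) T z"
        using pL zT by (simp add: g_def algebra_simps p_def u_def v_def add_divide_distrib)
      also have "\<dots> \<le> F z" unfolding F_def using K0 g0 by simp
      finally show ?thesis unfolding y_def p_def .
    qed
  qed
  have "(\<integral>\<^sup>+z. ennreal ((sqrt (mix_density e m 0 z / normal_density 0 1 z) - 1)\<^sup>2) \<partial>gauss 0)
      = (\<integral>\<^sup>+z. ennreal (normal_density 0 1 z * (sqrt (mix_density e m 0 z / normal_density 0 1 z) - 1)\<^sup>2) \<partial>lborel)"
    by (subst nn_integral_density) (auto simp: ennreal_mult)
  also have "\<dots> \<le> (\<integral>\<^sup>+z. ennreal (F z) \<partial>lborel)"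
    using pointwise by (intro nn_integral_mono ennreal_leI) auto
  also have "\<dots> = ennreal V"
    using FV e K0 g0 unfolding has_bochner_integral_iff
    by (subst nn_integral_eq_integral) (auto simp: F_def intro!: add_nonneg_nonneg mult_nonneg_nonneg)
  also have "V \<le> e\<^sup>2 * 1 + K * exp (- (max 0 (2 * m - a))\<^sup>2 / 2) + K * exp (- (max 0 (2 * m - a))\<^sup>2 / 2)
      + e * (2 * exp (- (max 0 (a - m))\<^sup>2 / 2)) + e / 2 * (2 * exp (- (max 0 (a - m))\<^sup>2 / 2))
      + e / 2 * (2 * exp (- (max 0 (a - m))\<^sup>2 / 2))"
    unfolding V_def
  proof (intro add_mono mult_left_mono)
    interpret G: prob_space "gauss 0" by (rule prob_space_gauss)
    show "measure (gauss 0) UNIV \<le> 1" by (rule G.prob_le_1)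
    show "measure (gauss (2 * m)) {..a} \<le> exp (- (max 0 (2 * m - a))\<^sup>2 / 2)" by (rule gauss_tail_le')
    show "measure (gauss (- 2 * m)) {- a..} \<le> exp (- (max 0 (2 * m - a))\<^sup>2 / 2)"
      using gauss_tail_le[of "- 2 * m" "- a"] by (simp add: algebra_simps)
    have T_le: "measure (gauss c) T \<le> 2 * exp (- (max 0 (a - m))\<^sup>2 / 2)" if "\<bar>c\<bar> \<le> m" for c
    proof -
      have "(max 0 (a - m))\<^sup>2 \<le> (max 0 (a - c))\<^sup>2" "(max 0 (a - m))\<^sup>2 \<le> (max 0 (a + c))\<^sup>2"
        using that by (intro power_mono; simp)+
      then have "exp (- (max 0 (a - c))\<^sup>2 / 2) + exp (- (max 0 (a + c))\<^sup>2 / 2)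
          \<le> 2 * exp (- (max 0 (a - m))\<^sup>2 / 2)"
        by (smt (verit) divide_right_mono exp_le_cancel_iff)
      then show ?thesis unfolding T_def using gauss_two_sided_le[of c a] by linarith
    qed
    show "measure (gauss 0) T \<le> 2 * exp (- (max 0 (a - m))\<^sup>2 / 2)"
      "measure (gauss m) T \<le> 2 * exp (- (max 0 (a - m))\<^sup>2 / 2)"
      "measure (gauss (- m)) T \<le> 2 * exp (- (max 0 (a - m))\<^sup>2 / 2)"
      using m T_le[of 0] T_le[of m] T_le[of "- m"] by simp_all
  qed (use e K0 in auto)
  also have "\<dots> = e\<^sup>2 * (1 + exp (m\<^sup>2 - (max 0 (2 * m - a))\<^sup>2 / 2)) + 4 * e * exp (- (max 0 (a - m))\<^sup>2 / 2)"
  proof -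
    have "exp (m\<^sup>2 - (max 0 (2 * m - a))\<^sup>2 / 2) = exp (m\<^sup>2) * exp (- (max 0 (2 * m - a))\<^sup>2 / 2)"
      by (simp flip: exp_add)
    then show ?thesis unfolding K_def by (simp add: algebra_simps)
  qed
  finally show ?thesis by (simp add: ennreal_leI)
qed

lemma mixture_eq_density_gauss:
  assumes "0 \<le> e" "e \<le> 1"
  shows "mixture e m 0 = density (gauss 0) (\<lambda>z. mix_density e m 0 z / normal_density 0 1 z)"
proof -
  have "ennreal (normal_density 0 1 z) * ennreal (mix_density e m 0 z / normal_density 0 1 z)
      = ennreal (mix_density e m 0 z)" for z
  proof -
    have "0 < normal_density 0 1 z" by (rule normal_density_pos) simp
    then show ?thesis using mix_density_nonneg[OF assms, of m 0 z]
      by (subst ennreal_mult[symmetric]) auto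
  qed
  then show ?thesis by (subst density_density_eq) auto
qed

lemma abs_measure_mixture_gauss_le:
  fixes N :: nat
  assumes e: "0 \<le> e" "e \<le> 1" and m: "0 \<le> m" and a: "0 \<le> a"
    and A: "A \<in> sets (\<Pi>\<^sub>M i\<in>{..<N}. gauss 0)"
    and D: "real N * (e\<^sup>2 * (1 + exp (m\<^sup>2 - (max 0 (2 * m - a))\<^sup>2 / 2))
      + 4 * e * exp (- (max 0 (a - m))\<^sup>2 / 2)) \<le> 2 * D" "0 < D"
  shows "\<bar>measure (\<Pi>\<^sub>M i\<in>{..<N}. mixture e m 0) A - measure (\<Pi>\<^sub>M i\<in>{..<N}. gauss 0) A\<bar> \<le> 3 * sqrt D"
  unfolding mixture_eq_density_gauss[OF e]
proof (rule abs_measure_PiM_density_diff_le[OF prob_space_gauss _ _ _ A hellinger_mixture_le[OF e m a] _ D])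
  show "prob_space (density (gauss 0) (\<lambda>z. ennreal (mix_density e m 0 z / normal_density 0 1 z)))"
    using prob_space_mixture[OF e, of m 0] mixture_eq_density_gauss[OF e] by metis
qed (use e mix_density_nonneg in auto)

subsection \<open>The detection boundary\<close>

lemma eventually_powr_le:
  assumes "a < b" "0 < (\<epsilon> :: real)"
  shows "\<forall>\<^sub>F N in sequentially. K * real N powr a \<le> \<epsilon> * real N powr b"
proof -
  have "(\<lambda>N. K * real N powr (a - b)) \<longlonglongrightarrow> K * 0"
    using assms by (intro tendsto_mult tendsto_const tendsto_neg_powr filterlim_real_sequentially) auto
  then have "\<forall>\<^sub>F N in sequentially. K * real N powr (a - b) < \<epsilon>"
    using assms by (intro order_tendstoD(2)) auto
  then show ?thesis
  proof (rule eventually_mono)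
    fix N assume *: "K * real N powr (a - b) < \<epsilon>"
    have "K * real N powr (a - b) * real N powr b \<le> \<epsilon> * real N powr b"
      using * by (intro mult_right_mono) auto
    moreover have "real N powr (a - b) * real N powr b = real N powr a"
      by (simp flip: powr_add)
    ultimately show "K * real N powr a \<le> \<epsilon> * real N powr b" by (simp add: mult.assoc)
  qed
qed

text \<open>The risk minus 1 is the difference of the two probabilities of one event, so a total
  variation bound handles every threshold at once. Truncating at \<open>sqrt (2 * ln N)\<close>
  makes the Hellinger bound a sum of powers of \<open>N\<close>; \<open>body\<close> and
  \<open>tail\<close> say that the exponents inside and beyond the truncation are negative.\<close>

lemma powerless_of_exponents:
  assumes \<beta>: "1/2 < \<beta>" and r: "0 < r" and \<gamma>: "\<gamma> < 1"
  defines "s \<equiv> sqrt (r / 2)"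
  assumes body: "1 - 2 * \<beta> + (2 * s\<^sup>2 - (max 0 (2 * s - 1))\<^sup>2) < 0"
    and tail: "1 - \<beta> - (max 0 (1 - s))\<^sup>2 < 0"
  shows "asymp_powerless (null_model \<nu>) (alt_model \<beta> r \<nu>) (HC_stat \<gamma>)"
  unfolding asymp_powerless_def
proof
  fix h :: "nat \<Rightarrow> real"
  \<comment> \<open>Half of \<open>N\<close> times the marginal bound; the extra
    \<open>real N powr - 1\<close> keeps \<open>D N\<close> strictly positive.\<close>
  define D where "D N = (real N powr (1 - 2 * \<beta>)
      + real N powr (1 - 2 * \<beta> + (2 * s\<^sup>2 - (max 0 (2 * s - 1))\<^sup>2))
      + 4 * real N powr (1 - \<beta> - (max 0 (1 - s))\<^sup>2)) / 2 + real N powr - 1" for N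
  define R where "R N = test_risk (null_model \<nu> N) (alt_model \<beta> r \<nu> N) (HC_stat \<gamma> N) (h N)" for N
  have s: "0 < s" unfolding s_def using r by simp
  have pw: "(\<lambda>N. real N powr c) \<longlonglongrightarrow> 0" if "c < 0" for c
    using that by (intro tendsto_neg_powr filterlim_real_sequentially)
  have "D \<longlonglongrightarrow> (0 + 0 + 4 * 0) / 2 + 0"
    unfolding D_def[abs_def] using body tail \<beta> by (intro tendsto_intros pw) auto
  then have lim: "(\<lambda>N. 3 * sqrt (D N)) \<longlonglongrightarrow> 3 * sqrt 0" by (intro tendsto_intros) auto
  have bound: "\<bar>R N - 1\<bar> \<le> 3 * sqrt (D N)" if N: "1 \<le> N" for N
  proof -
    define A where "A = sqrt (2 * ln (real N))"
    define e where "e = eps_N \<beta> N"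
    let ?P0 = "null_law N" and ?P1 = "alt_law \<beta> s N"
    have e: "0 \<le> e" "e \<le> 1" unfolding e_def using eps_N_bounds[of \<beta> N] \<beta> by auto
    have L: "0 \<le> ln (real N)" using N by simp
    have A: "0 \<le> A" "A\<^sup>2 = 2 * ln (real N)" unfolding A_def using L by simp_all
    have x: "0 < real N" using N by simp
    define E where "E = {z \<in> space ?P0. HC \<gamma> N (\<lambda>i. pval (z i)) \<le> h N}"
    have sets_eq: "sets ?P1 = sets ?P0" by (intro sets_PiM_cong) auto
    have space_eq: "space ?P1 = space ?P0" by (rule sets_eq_imp_space_eq[OF sets_eq])
    have H: "(\<lambda>z. HC \<gamma> N (\<lambda>i. pval (z i))) \<in> borel_measurable ?P0"
      by (intro measurable_HC[OF \<gamma>] measurable_compose[OF _ measurable_pval]) simp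
    then have E: "E \<in> sets ?P0" unfolding E_def by measurable
    interpret P0: prob_space ?P0 by (rule prob_space_PiM[OF prob_space_gauss])
    have "{z \<in> space ?P0. HC \<gamma> N (\<lambda>i. pval (z i)) > h N} = space ?P0 - E"
      unfolding E_def by auto
    moreover have "{z \<in> space ?P1. HC \<gamma> N (\<lambda>i. pval (z i)) \<le> h N} = E"
      unfolding E_def space_eq ..
    moreover have "0 < \<beta>" using \<beta> by simp
    ultimately have risk: "R N - 1 = measure ?P1 E - measure ?P0 E"
      unfolding R_def s_def using E by (simp add: HC_risk_eq[OF _ \<gamma>] P0.prob_compl)
    have ex: "exp (c * ln (real N)) = real N powr c" for c using x by (simp add: powr_def)
    have maxA: "max 0 (c * A) = max 0 c * A" for c
      using A(1) by (cases "0 \<le> c") (simp_all add: max_def mult_nonneg_nonneg mult_nonpos_nonneg antisym)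
    have e1: "exp ((s * A)\<^sup>2 - (max 0 (2 * (s * A) - A))\<^sup>2 / 2)
        = real N powr (2 * s\<^sup>2 - (max 0 (2 * s - 1))\<^sup>2)"
    proof -
      have "max 0 (2 * (s * A) - A) = max 0 (2 * s - 1) * A"
        using maxA[of "2 * s - 1"] by (simp add: algebra_simps)
      then show ?thesis by (simp add: power_mult_distrib A(2) algebra_simps flip: ex)
    qed
    have e2: "exp (- (max 0 (A - s * A))\<^sup>2 / 2) = real N powr - (max 0 (1 - s))\<^sup>2"
    proof -
      have "max 0 (A - s * A) = max 0 (1 - s) * A"
        using maxA[of "1 - s"] by (simp add: algebra_simps)
      then show ?thesis by (simp add: power_mult_distrib A(2) algebra_simps flip: ex)
    qed
    have "\<bar>measure ?P1 E - measure ?P0 E\<bar> \<le> 3 * sqrt (D N)"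
      unfolding e_def[symmetric] A_def[symmetric]
    proof (rule abs_measure_mixture_gauss_le[OF e _ A(1) E])
      show "0 \<le> s * A" using s A by simp
      show "0 < D N" unfolding D_def using x by (intro add_nonneg_pos) auto
      have "real N * (e\<^sup>2 * (1 + exp ((s * A)\<^sup>2 - (max 0 (2 * (s * A) - A))\<^sup>2 / 2))
          + 4 * e * exp (- (max 0 (A - s * A))\<^sup>2 / 2)) = 2 * (D N - real N powr - 1)"
      proof -
        have "real N = real N powr 1" "e\<^sup>2 = real N powr (- 2 * \<beta>)"
          using x unfolding e_def eps_N_def by (simp_all add: power2_eq_square flip: powr_add)
        then have a: "real N * e\<^sup>2 = real N powr (1 - 2 * \<beta>)"
          by (metis powr_add diff_conv_add_uminus mult_minus_left)
        have b: "real N * e = real N powr (1 - \<beta>)"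
          unfolding e_def eps_N_def using x by (simp add: powr_diff powr_minus field_simps)
        have "real N * (e\<^sup>2 * (1 + real N powr (2 * s\<^sup>2 - (max 0 (2 * s - 1))\<^sup>2))
            + 4 * e * real N powr - (max 0 (1 - s))\<^sup>2)
          = real N * e\<^sup>2 + real N * e\<^sup>2 * real N powr (2 * s\<^sup>2 - (max 0 (2 * s - 1))\<^sup>2)
            + 4 * (real N * e * real N powr - (max 0 (1 - s))\<^sup>2)"
          by (simp add: algebra_simps)
        also have "\<dots> = 2 * (D N - real N powr - 1)"
          unfolding a b D_def by (simp flip: powr_add)
        finally show ?thesis unfolding e1 e2 .
      qed
      then show "real N * (e\<^sup>2 * (1 + exp ((s * A)\<^sup>2 - (max 0 (2 * (s * A) - A))\<^sup>2 / 2))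
          + 4 * e * exp (- (max 0 (A - s * A))\<^sup>2 / 2)) \<le> 2 * D N" using x by simp
    qed
    then show ?thesis unfolding risk .
  qed
  have "(\<lambda>N. R N - 1) \<longlonglongrightarrow> 0"
  proof (rule Lim_null_comparison)
    show "\<forall>\<^sub>F N in sequentially. norm (R N - 1) \<le> 3 * sqrt (D N)"
      using bound by (auto simp: eventually_sequentially intro!: exI[of _ 1])
    show "(\<lambda>N. 3 * sqrt (D N)) \<longlonglongrightarrow> 0" using lim by simp
  qed
  then show "(\<lambda>N. test_risk (null_model \<nu> N) (alt_model \<beta> r \<nu> N) (HC_stat \<gamma> N) (h N)) \<longlonglongrightarrow> 1"
    unfolding R_def by (rule LIM_zero_cancel)
qed

section \<open>Detection above the boundary\<close>

lemma null_bound_tendsto_0: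
  assumes "0 < c" "0 < \<delta>"
  shows "(\<lambda>N. real N * (exp (- (real N powr \<delta> * c)\<^sup>2 / 16) + exp (- sqrt (real N powr \<delta> * c)))
      + 3 / (real N powr \<delta> * c)) \<longlonglongrightarrow> 0"
  using assms by real_asymp

text \<open>At the level \<open>u * sqrt (2 * ln N)\<close> the mean number of signal exceedances
  has exponent \<open>\<kappa> = 1 - \<beta> - w^2\<close>, and the null standard deviation has
  exponent \<open>\<eta> = (1 - u^2) / 2\<close>. The assumption \<open>gap\<close> says that the
  signal wins by a power of \<open>N\<close>, leaving room for a polynomial threshold.\<close>

lemma powerful_of_exponents:
  assumes \<beta>: "0 < \<beta>" and r: "0 < r" and \<gamma>: "0 < \<gamma>" "\<gamma> < 1" and u: "0 < u" "u \<le> 1"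
  defines "s \<equiv> sqrt (r / 2)"
  defines "w \<equiv> max 0 (u - s)"
  assumes gap: "(1 - u\<^sup>2) / 2 < 1 - \<beta> - w\<^sup>2"
  shows "asymp_powerful (null_model \<nu>) (alt_model \<beta> r \<nu>) (HC_stat \<gamma>)"
proof -
  define \<kappa> \<eta> where "\<kappa> = 1 - \<beta> - w\<^sup>2" and "\<eta> = (1 - u\<^sup>2) / 2"
  have s: "0 < s" unfolding s_def using r by simp
  have w: "0 \<le> w" "w < u" unfolding w_def using u s by auto
  have w2: "w\<^sup>2 < u\<^sup>2" using w by (intro power_strict_mono) auto
  have \<eta>: "0 \<le> \<eta>" unfolding \<eta>_def using u by (simp add: power_le_one)
  have \<eta>\<kappa>: "\<eta> < \<kappa>" using gap unfolding \<kappa>_def \<eta>_def .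
  have \<kappa>: "\<kappa> < 1" unfolding \<kappa>_def using \<beta> zero_le_power2[of w] by linarith
  \<comment> \<open>The gap \<open>\<kappa> - \<eta>\<close> must absorb \<open>\<delta>\<close>
    twice, for the threshold and for the loss in the Gaussian lower bound. The second bound keeps
    the null tail \<open>N powr (- u^2)\<close> below the signal tail.\<close>
  define \<delta> where "\<delta> = min ((\<kappa> - \<eta>) / 4) ((u\<^sup>2 - w\<^sup>2) / 2)"
  have \<delta>: "0 < \<delta>" "2 * \<delta> < \<kappa> - \<eta>" "\<delta> < u\<^sup>2 - w\<^sup>2"
    unfolding \<delta>_def using \<eta>\<kappa> w2 by (auto simp: min_def)
  define C where "C = exp (- 1 / 2) / sqrt (2 * pi)"
  have C: "0 < C" unfolding C_def by simp
  define h where "h N = real N powr \<delta>" for N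
  define null_bd where "null_bd N = real N * (exp (- (h N * sqrt (1 - \<gamma>))\<^sup>2 / 16)
      + exp (- sqrt (h N * sqrt (1 - \<gamma>)))) + 3 / (h N * sqrt (1 - \<gamma>))" for N
  have "null_bd \<longlonglongrightarrow> 0"
    unfolding null_bd_def[abs_def] h_def using \<gamma> \<delta>(1) by (intro null_bound_tendsto_0) auto
  moreover have "(\<lambda>N. exp (- h N / 2)) \<longlonglongrightarrow> 0"
    unfolding h_def using \<delta>(1) by real_asymp
  ultimately have lim: "(\<lambda>N. null_bd N + exp (- h N / 2)) \<longlonglongrightarrow> 0"
    using tendsto_add by force
  \<comment> \<open>The cross term left by \<open>gauss_tail_ge\<close> costs less than
    \<open>N powr \<delta>\<close>, as \<open>sqrt (ln N)\<close> is negligible against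
    \<open>ln N\<close>.\<close>
  have ev_exp: "\<forall>\<^sub>F N in sequentially. exp (- w * sqrt (2 * ln (real N))) \<ge> real N powr (- \<delta>)"
  proof -
    have "filterlim (\<lambda>N. ln (real N)) at_top sequentially"
      by (rule filterlim_compose[OF ln_at_top filterlim_real_sequentially])
    then have "\<forall>\<^sub>F N in sequentially. 2 * w\<^sup>2 / \<delta>\<^sup>2 \<le> ln (real N)"
      by (simp add: filterlim_at_top)
    then show ?thesis
      using eventually_ge_at_top[of 1]
    proof eventually_elim
      case (elim N)
      then have L: "0 \<le> ln (real N)" by simp
      have "2 * w\<^sup>2 \<le> \<delta>\<^sup>2 * ln (real N)" using elim \<delta>(1) by (simp add: field_simps)
      then have "2 * w\<^sup>2 * ln (real N) \<le> \<delta>\<^sup>2 * ln (real N) * ln (real N)"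
        using L by (rule mult_right_mono)
      then have "(w * sqrt (2 * ln (real N)))\<^sup>2 \<le> (\<delta> * ln (real N))\<^sup>2"
        using L by (simp add: power_mult_distrib) (simp add: power2_eq_square mult_ac)
      then have "w * sqrt (2 * ln (real N)) \<le> \<delta> * ln (real N)"
        using L \<delta>(1) by (elim power2_le_imp_le) simp
      then show ?case using elim by (simp add: powr_def)
    qed
  qed
  \<comment> \<open>\<open>ev1\<close> gives \<open>t < 1\<close>; \<open>ev2\<close> to
    \<open>ev4\<close> give \<open>room\<close>; \<open>ev5\<close> keeps the null tail below half
    of the signal tail; \<open>ev6\<close> compares signal and noise; \<open>ev7\<close> and
    \<open>ev8\<close> serve \<open>null_HC_tail\<close>.\<close>
  have ev1: "\<forall>\<^sub>F N in sequentially. 2 * real N powr (- (u\<^sup>2)) \<le> 1 / 2 * real N powr 0"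
    and ev2: "\<forall>\<^sub>F N in sequentially. 2 * real N powr (2 * \<eta>) \<le> \<gamma> / 4 * real N powr 1"
    and ev3: "\<forall>\<^sub>F N in sequentially. sqrt 2 * real N powr (\<delta> + \<eta>) \<le> \<gamma> / 4 * real N powr 1"
    and ev4: "\<forall>\<^sub>F N in sequentially. 2 * real N powr 0 \<le> \<gamma> / 4 * real N powr 1"
    and ev5: "\<forall>\<^sub>F N in sequentially. 2 * real N powr (w\<^sup>2 - u\<^sup>2) \<le> C / 2 * real N powr (- \<delta>)"
    and ev6: "\<forall>\<^sub>F N in sequentially. 8 * sqrt 2 * real N powr (\<delta> + \<eta>) \<le> C / 2 * real N powr (\<kappa> - \<delta>)"
    and ev7: "\<forall>\<^sub>F N in sequentially. 1 * real N powr 0 \<le> sqrt (1 - \<gamma>) * real N powr \<delta>"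
    and ev8: "\<forall>\<^sub>F N in sequentially. 1 * real N powr 0 \<le> \<gamma> * real N powr 1"
    by (rule eventually_powr_le; use u \<gamma> \<delta> C \<kappa> \<eta> \<eta>\<kappa> in \<open>simp add: \<eta>_def\<close>)+
  have risk: "\<forall>\<^sub>F N in sequentially. norm (test_risk (null_model \<nu> N) (alt_model \<beta> r \<nu> N) (HC_stat \<gamma> N) (h N))
      \<le> null_bd N + exp (- h N / 2)"
    using ev_exp ev1 ev2 ev3 ev4 ev5 ev6 ev7 ev8
      eventually_ge_at_top[of 1]
  proof eventually_elim
    case (elim N)
    define A where "A = sqrt (2 * ln (real N))"
    define z0 where "z0 = u * A"
    define t where "t = pval z0"
    define \<tau> where "\<tau> = real N * t"
    have N: "1 \<le> N" and x: "0 < real N" using elim by auto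
    have L: "0 \<le> ln (real N)" using N by simp
    have A: "0 \<le> A" "A\<^sup>2 = 2 * ln (real N)" unfolding A_def using L by simp_all
    have ex: "exp (c * ln (real N)) = real N powr c" for c using x by (simp add: powr_def)
    have h1: "1 \<le> h N" unfolding h_def using N \<delta>(1) by (simp add: ge_one_powr_ge_zero)
    have z0: "0 \<le> z0" unfolding z0_def using u A by simp
    have "exp (- z0\<^sup>2 / 2) = real N powr (- (u\<^sup>2))"
      unfolding z0_def by (simp add: power_mult_distrib A(2) flip: ex)
    then have t: "t \<le> 2 * real N powr (- (u\<^sup>2))" unfolding t_def using pval_le[OF z0] by simp
    have t1: "t < 1" using t elim(2) u x by simp
    have "2 * \<eta> = 1 + - (u\<^sup>2)" unfolding \<eta>_def by simp
    then have "real N powr (2 * \<eta>) = real N * real N powr (- (u\<^sup>2))"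
      using x by (simp only: powr_add) simp
    then have \<tau>: "\<tau> \<le> 2 * real N powr (2 * \<eta>)"
      unfolding \<tau>_def using mult_left_mono[OF t, of "real N"] x by simp
    have \<tau>0: "0 < \<tau>" unfolding \<tau>_def t_def using x pval_pos by simp
    have "sqrt \<tau> \<le> sqrt (2 * real N powr (2 * \<eta>))" using \<tau> by simp
    also have "\<dots> = sqrt 2 * real N powr \<eta>"
      by (simp add: real_sqrt_mult powr_half_sqrt[symmetric] powr_powr)
    finally have sq\<tau>: "h N * sqrt \<tau> \<le> sqrt 2 * real N powr (\<delta> + \<eta>)"
      using mult_left_mono[of "sqrt \<tau>" "sqrt 2 * real N powr \<eta>" "h N"] h1
      unfolding h_def by (simp add: powr_add mult_ac)
    have room: "\<tau> + h N * sqrt \<tau> + 2 \<le> \<gamma> * real N"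
      using \<tau> sq\<tau> elim(3,4,5) \<eta>\<kappa> \<kappa> \<delta> \<gamma> x by simp
    define g where "g = measure (gauss (s * A)) {z0..}"
    have "C * real N powr (- (w\<^sup>2)) * exp (- w * A) \<le> g"
    proof -
      interpret G: prob_space "gauss (s * A)" by (rule prob_space_gauss)
      \<comment> \<open>If the signal mean already exceeds the level, the tail is taken from the
        mean on, at distance \<open>w * A = 0\<close>.\<close>
      have wA: "max (s * A) z0 - s * A = w * A"
      proof (cases "u \<le> s")
        case True
        then show ?thesis
          unfolding w_def z0_def using mult_right_mono[OF True A(1)] by (simp add: max_def)
      next
        case False
        then have "s * A \<le> u * A" using A(1) by (intro mult_right_mono) auto
        then show ?thesis unfolding w_def z0_def using False by (simp add: max_def algebra_simps)
      qed
      have "exp (- (w * A + 1)\<^sup>2 / 2) / sqrt (2 * pi) \<le> measure (gauss (s * A)) {max (s * A) z0..}"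
        using gauss_tail_ge[of "s * A" "max (s * A) z0"] unfolding wA by simp
      also have "\<dots> \<le> g" unfolding g_def by (intro G.finite_measure_mono) auto
      also have "- (w * A + 1)\<^sup>2 / 2 = - (w\<^sup>2) * ln (real N) + - w * A + - 1 / 2"
      proof -
        have "(w * A + 1)\<^sup>2 = w\<^sup>2 * A\<^sup>2 + 2 * (w * A) + 1" by (simp add: power2_eq_square algebra_simps)
        also have "\<dots> = 2 * (w\<^sup>2 * ln (real N) + w * A + 1 / 2)" unfolding A(2) by simp
        finally show ?thesis by simp
      qed
      finally show ?thesis unfolding C_def exp_add ex by (simp add: mult_ac)
    qed
    moreover have "C * real N powr (- (w\<^sup>2)) * real N powr (- \<delta>) \<le> C * real N powr (- (w\<^sup>2)) * exp (- w * A)"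
      unfolding A_def using elim(1) C by (intro mult_left_mono) auto
    ultimately have g: "C * real N powr (- (w\<^sup>2)) * real N powr (- \<delta>) \<le> g" by linarith
    have "2 * real N powr (- (u\<^sup>2)) = real N powr (- (w\<^sup>2)) * (2 * real N powr (w\<^sup>2 - u\<^sup>2))"
      by (simp flip: powr_add)
    also have "\<dots> \<le> real N powr (- (w\<^sup>2)) * (C / 2 * real N powr (- \<delta>))"
      using elim(6) \<delta> C by (intro mult_left_mono) auto
    finally have gt: "C / 2 * (real N powr (- (w\<^sup>2)) * real N powr (- \<delta>)) \<le> g - t"
      using t g by (simp add: mult_ac)
    have "real N * eps_N \<beta> N = real N powr (1 - \<beta>)"
      unfolding eps_N_def using x by (simp add: powr_diff powr_minus field_simps)
    then have "C / 2 * real N powr (\<kappa> - \<delta>)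
        = real N * eps_N \<beta> N * (C / 2 * (real N powr (- (w\<^sup>2)) * real N powr (- \<delta>)))"
      unfolding \<kappa>_def by (simp add: algebra_simps flip: powr_add)
    also have "\<dots> \<le> real N * eps_N \<beta> N * (g - t)"
      using gt eps_N_bounds[OF \<beta>, of N] by (intro mult_left_mono) auto
    finally have b: "8 * sqrt 2 * real N powr (\<delta> + \<eta>) \<le> real N * eps_N \<beta> N * (g - t)"
      using elim(7) \<delta> C by simp
    have "h N \<le> real N powr (\<delta> + \<eta>)" unfolding h_def using N \<eta> by (intro powr_mono) auto
    also have "\<dots> \<le> sqrt 2 * real N powr (\<delta> + \<eta>)" by (simp add: mult_le_cancel_right1)
    finally have b2: "8 * h N \<le> real N * eps_N \<beta> N * (g - t)" using b by linarith
    have b1: "8 * h N * sqrt \<tau> \<le> real N * eps_N \<beta> N * (g - t)" using b sq\<tau> by linarith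
    have "measure (alt_law \<beta> s N) {z \<in> space (alt_law \<beta> s N). HC \<gamma> N (\<lambda>i. pval (z i)) \<le> h N}
        \<le> exp (- h N / 2)"
      unfolding A_def[symmetric]
      by (rule alt_HC_tail[OF \<gamma>(2) _ _ z0])
        (use eps_N_bounds[OF \<beta>, of N] t1 h1 room b1 b2 in \<open>simp_all add: t_def \<tau>_def g_def\<close>)
    moreover have "measure (null_law N) {z \<in> space (null_law N). HC \<gamma> N (\<lambda>i. pval (z i)) > h N} \<le> null_bd N"
    proof -
      have "1 \<le> h N * sqrt (1 - \<gamma>)" using elim(8) \<delta> \<gamma> x unfolding h_def by (simp add: mult.commute)
      moreover have "1 \<le> \<gamma> * real N" using elim(9) \<gamma> x by simp
      ultimately show ?thesis
        unfolding null_bd_def using h1 \<gamma> by (intro null_HC_tail) auto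
    qed
    ultimately show ?case
      unfolding HC_risk_eq[OF \<beta> \<gamma>(2)] s_def[symmetric] by simp
  qed
  have "(\<lambda>N. test_risk (null_model \<nu> N) (alt_model \<beta> r \<nu> N) (HC_stat \<gamma> N) (h N)) \<longlonglongrightarrow> 0"
    by (rule Lim_null_comparison[OF risk lim])
  then show ?thesis unfolding asymp_powerful_def by blast
qed

theorem theorem3:
  fixes \<beta> r \<gamma>0 :: real and \<nu> :: "nat \<Rightarrow> nat \<Rightarrow> real"
  assumes "1/2 < \<beta>" "\<beta> < 1" "0 < r" "0 < \<gamma>0" "\<gamma>0 < 1"
  shows "(r > rho_high \<beta> \<longrightarrow>
            asymp_powerful (null_model \<nu>) (alt_model \<beta> r \<nu>) (HC_stat \<gamma>0))
       \<and> (r < rho_high \<beta> \<longrightarrow>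
            asymp_powerless (null_model \<nu>) (alt_model \<beta> r \<nu>) (HC_stat \<gamma>0))"
proof (intro conjI impI)
  define s where "s = sqrt (r / 2)"
  define q where "q = sqrt (1 - \<beta>)"
  have s: "0 < s" "r = 2 * s\<^sup>2" unfolding s_def using assms by simp_all
  have q: "0 < q" "q\<^sup>2 = 1 - \<beta>" unfolding q_def using assms by simp_all
  have q2: "q\<^sup>2 < 1 / 2" using q assms by simp
  have q1: "q < 1" using q q2 by (intro power_less_imp_less_base[of q 2 1]) auto
  have rho: "rho_high \<beta> = (if \<beta> < 3/4 then 2 * (\<beta> - 1/2) else 2 * (1 - q)\<^sup>2)"
    unfolding rho_high_def q_def ..
  have q_half: "1 / 2 < q \<longleftrightarrow> \<beta> < 3 / 4"
  proof -
    have "1 / 2 < q \<longleftrightarrow> (1 / 2)\<^sup>2 < q\<^sup>2"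
      using q power_strict_mono[of "1 / 2" q 2] power_mono[of q "1 / 2" 2] by force
    then show ?thesis using q by (simp add: power2_eq_square)
  qed
  {
    assume "r > rho_high \<beta>"
    show "asymp_powerful (null_model \<nu>) (alt_model \<beta> r \<nu>) (HC_stat \<gamma>0)"
    proof (cases "1 - q < s")
      case True
      \<comment> \<open>At level \<open>u = 1\<close> the null exponent is 0, and the gap condition
        reads \<open>(max 0 (1 - s))^2 < q^2\<close>.\<close>
      have "max 0 (1 - s) < q" using True q by simp
      then have "(max 0 (1 - s))\<^sup>2 < q\<^sup>2" by (intro power_strict_mono) auto
      then show ?thesis using assms q
        by (intro powerful_of_exponents[of \<beta> r \<gamma>0 1]) (auto simp: s_def[symmetric])
    next
      case False
      \<comment> \<open>Now \<open>s \<le> 1 - q\<close> rules out the second branch of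
        \<open>rho_high\<close>. With \<open>u = 2 * s\<close> one has \<open>w = s\<close>, and the
        gap condition reduces to \<open>\<beta> - 1 / 2 < s^2\<close>; \<open>s < 1 / 2\<close>
        gives \<open>u \<le> 1\<close>.\<close>
      have "(s)\<^sup>2 \<le> (1 - q)\<^sup>2" using False s by (intro power_mono) auto
      then have b: "\<beta> < 3 / 4" using \<open>r > rho_high \<beta>\<close> s unfolding rho by (auto split: if_splits)
      then have s2: "\<beta> - 1 / 2 < s\<^sup>2" using \<open>r > rho_high \<beta>\<close> s unfolding rho by auto
      have "s < 1 / 2" using False b q_half by simp
      then show ?thesis using assms s s2
        by (intro powerful_of_exponents[of \<beta> r \<gamma>0 "2 * s"])
          (auto simp: s_def[symmetric] max_def power_mult_distrib field_simps)
    qed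
  next
    assume "r < rho_high \<beta>"
    \<comment> \<open>For \<open>\<beta> > 3 / 4\<close> the bound \<open>s^2 \<le> 1 / 4\<close>
      suffices; only at \<open>\<beta> = 3 / 4\<close> does strictness come from
      \<open>r < rho_high \<beta>\<close>.\<close>
    have s_half: "s\<^sup>2 < \<beta> - 1 / 2" if "s \<le> 1 / 2"
    proof (cases "\<beta> < 3 / 4")
      case True
      then show ?thesis using \<open>r < rho_high \<beta>\<close> s unfolding rho by simp
    next
      case False
      then have ge: "2 * s\<^sup>2 < 2 * (1 - q)\<^sup>2" using \<open>r < rho_high \<beta>\<close> s unfolding rho by simp
      have "s\<^sup>2 \<le> (1 / 2)\<^sup>2" using that s by (intro power_mono) auto
      then have le: "s\<^sup>2 \<le> 1 / 4" by (simp add: power2_eq_square)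
      show ?thesis
      proof (cases "\<beta> = 3 / 4")
        case True
        then have "q\<^sup>2 = (1 / 2)\<^sup>2" using q by (simp add: power2_eq_square)
        then have "q = 1 / 2" using q by (simp add: power2_eq_iff)
        then show ?thesis using ge True by (simp only: power2_eq_square) simp
      qed (use False le in simp)
    qed
    \<comment> \<open>In the first branch \<open>s^2 + q^2 < 1 / 2\<close>, and
      \<open>(s + q)^2 \<le> 2 * (s^2 + q^2)\<close>.\<close>
    have s_q: "s < 1 - q"
    proof (cases "\<beta> < 3 / 4")
      case True
      then have "s\<^sup>2 + q\<^sup>2 < 1 / 2" using \<open>r < rho_high \<beta>\<close> s q unfolding rho by simp
      moreover have "0 \<le> (s - q)\<^sup>2" by simp
      ultimately have "(s + q)\<^sup>2 < 1\<^sup>2" by (simp add: power2_eq_square algebra_simps)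
      then have "s + q < 1" by (rule power_less_imp_less_base) simp
      then show ?thesis by simp
    next
      case False
      then have "s\<^sup>2 < (1 - q)\<^sup>2" using \<open>r < rho_high \<beta>\<close> s unfolding rho by simp
      then show ?thesis using q1 by (intro power_less_imp_less_base[of s 2 "1 - q"]) auto
    qed
    have "q < max 0 (1 - s)" using s_q by simp
    then have tail: "q\<^sup>2 < (max 0 (1 - s))\<^sup>2" using q by (intro power_strict_mono) auto
    have body: "1 - 2 * \<beta> + (2 * s\<^sup>2 - (max 0 (2 * s - 1))\<^sup>2) < 0"
    proof (cases "s \<le> 1 / 2")
      case True
      then have "max 0 (2 * s - 1) = 0" by simp
      then show ?thesis using s_half[OF True] by simp
    next
      case False
      \<comment> \<open>For \<open>s > 1 / 2\<close> the exponent in \<open>body\<close> equals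
        \<open>2 * q^2 - 2 * (1 - s)^2\<close>.\<close>
      have "q\<^sup>2 < (1 - s)\<^sup>2" using s_q q by (intro power_strict_mono) auto
      moreover have "max 0 (2 * s - 1) = 2 * s - 1" using False by simp
      ultimately show ?thesis using q by (simp add: power2_eq_square algebra_simps)
    qed
    show "asymp_powerless (null_model \<nu>) (alt_model \<beta> r \<nu>) (HC_stat \<gamma>0)"
      using assms body tail q by (intro powerless_of_exponents) (simp_all add: s_def)
  }
qed

end
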